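(* Let $r\ge 3$, $n=2r-2$ and let $\lambda$ be the composition $(1,2^{r-2},1)$ of $n$ (that is, $\lambda$ has $r$ parts, the first and last equal to $1$ and the other $r-2$ parts equal to $2$). Define $$P^{(0)}=\{(i,1) : 1\le i\le r\}\cup\{(i,2) : 2\le i\le r-1\},$$ $$P^{(r-2)}=\{(i,1) : 2\le i\le r-1\}\cup\{(i,2) : 1\le i\le r\},$$ and, for $1\le v\le r-3$, $$P^{(v)}=\{(i,1) : 2\le i\le v+1\}\cup\{(i,2) : 1\le i\le r\}\cup\{(i,3) : v+2\le i\le r-1\}.$$ Then $\mathcal E^{(\lambda)}=\{P^{(v)} : 0\le v\le r-2\}$ and $\mathcal E_s^{(\lambda)}=\{P^{(0)},P^{(r-2)}\}$. So $|\mathcal E_s^{(\lambda)}|=2$ and $|\mathcal E^{(\lambda)}|=r-1$.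
   Context: A composition $\lambda=(\lambda_1,\ldots,\lambda_r)$ of $n$ is a finite sequence of positive integers with sum $n$. $S_n$ acts on the right on $\{1,\ldots,n\}$ (products are composed left to right), with Coxeter generators $S=\{s_1,\ldots,s_{n-1}\}$, $s_i=(i,i+1)$, and Coxeter length $l$. An element $x$ is a prefix of $y$ if $y$ has a reduced expression beginning with a reduced expression for $x$ (equivalently $l(y)=l(x)+l(x^{-1}y)$). For a composition $\lambda$ of $n$ let $J(\lambda)=S\setminus\{s_{\lambda_1},s_{\lambda_1+\lambda_2},\ldots,s_{\lambda_1+\cdots+\lambda_{r-1}}\}$, let $W_{J(\lambda)}=\langle J(\lambda)\rangle$, let $w_{J(\lambda)}$ be its longest element, and let $\mathfrak{X}_{J(\lambda)}$ be the set of minimum length representatives of the right cosets $W_{J(\lambda)}w$. $\sim_R$ is the Kazhdan-Lusztig right cell equivalence on $S_n$; explicitly, $w\sim_R w'$ if and only if the Robinson-Schensted recording tableaux agree, $\mathcal Q(w)=\mathcal Q(w')$, where $w$ is inserted via its row-form $[1w,\ldots,nw]$. $Z(\lambda)=\{e\in\mathfrak{X}_{J(\lambda)} : w_{J(\lambda)}e\sim_R w_{J(\lambda)}\}$ and $Y(\lambda)=\{x\in Z(\lambda) : x\text{ is not a prefix of any other }y\in Z(\lambda)\}$. A diagram $D$ is a non-empty finite subset of $\mathbb Z^2$ whose nodes $(a,b)$ have row index $a$ and column index $b$ (rows top to bottom, columns left to right), with no empty rows or columns, and both rows and columns indexed consecutively from $1$. $\mathcal D^{(\lambda)}$ is the set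 of diagrams whose $k$-th row has exactly $\lambda_k$ nodes for each $k$ (and having exactly $r$ rows). For a diagram $D$ of size $n$, $t^D$ and $t_D$ are the bijections $D\to\{1,\ldots,n\}$ filling the nodes of $D$ with $1,\ldots,n$ by rows and by columns respectively, and $w_D\in S_n$ is defined by $t^Dw_D=t_D$, where $tw$ is obtained from $t$ by replacing each entry $i$ by $iw$. For $d\in\mathfrak{X}_{J(\lambda)}$, $D(d,\lambda)$ is the unique diagram with the minimum number of columns among all $E\in\mathcal D^{(\lambda)}$ with $w_E=d$ (such diagrams exist, and the minimal one is known to be unique). A diagram is special if it is obtained from a Young diagram by permuting rows and columns. $\mathcal E^{(\lambda)}=\{D(y,\lambda) : y\in Y(\lambda)\}$ and $\mathcal E_s^{(\lambda)}=\{D\in\mathcal E^{(\lambda)} : D\text{ is special}\}$. *)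

theory Defs
  imports "HOL-Algebra.Generated_Groups" "HOL-Combinatorics.Permutations"
begin

section \<open>The symmetric group acting on the right\<close>

text \<open>The image \<open>iw\<close> of a point \<open>i\<close> under \<open>w\<close> is the function application \<open>w i\<close>, and products are
  composed from left to right, so that \<open>i(xy) = (ix)y\<close>. (The group \<open>sym_group\<close> of
  HOL-Algebra composes in the opposite order.)\<close>

definition symR :: "nat \<Rightarrow> (nat \<Rightarrow> nat) monoid" where
  "symR n = \<lparr>carrier = {p. p permutes {1..n}}, monoid.mult = (\<lambda>x y. y \<circ> x), one = id\<rparr>"

definition cox_gens :: "nat \<Rightarrow> (nat \<Rightarrow> nat) set" where
  "cox_gens n = {transpose i (i + 1) |i. 1 \<le> i \<and> i < n}"

definition word_prod :: "nat \<Rightarrow> (nat \<Rightarrow> nat) list \<Rightarrow> (nat \<Rightarrow> nat)" where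
  "word_prod n ws = foldr (\<lambda>x y. x \<otimes>\<^bsub>symR n\<^esub> y) ws \<one>\<^bsub>symR n\<^esub>"

definition expression_of :: "nat \<Rightarrow> (nat \<Rightarrow> nat) list \<Rightarrow> (nat \<Rightarrow> nat) \<Rightarrow> bool" where
  "expression_of n ws w \<longleftrightarrow> set ws \<subseteq> cox_gens n \<and> word_prod n ws = w"

definition cox_length :: "nat \<Rightarrow> (nat \<Rightarrow> nat) \<Rightarrow> nat" where
  "cox_length n w = (LEAST k. \<exists>ws. expression_of n ws w \<and> length ws = k)"

definition reduced_expression_of :: "nat \<Rightarrow> (nat \<Rightarrow> nat) list \<Rightarrow> (nat \<Rightarrow> nat) \<Rightarrow> bool" where
  "reduced_expression_of n ws w \<longleftrightarrow> expression_of n ws w \<and> length ws = cox_length n w"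

definition cox_prefix :: "nat \<Rightarrow> (nat \<Rightarrow> nat) \<Rightarrow> (nat \<Rightarrow> nat) \<Rightarrow> bool" where
  "cox_prefix n x y \<longleftrightarrow>
     (\<exists>us vs. reduced_expression_of n us x \<and> reduced_expression_of n (us @ vs) y)"


section \<open>Parabolic subgroups attached to a composition\<close>

definition is_composition :: "nat \<Rightarrow> nat list \<Rightarrow> bool" where
  "is_composition n lam \<longleftrightarrow> (\<forall>m\<in>set lam. 0 < m) \<and> sum_list lam = n"

text \<open>From here on a composition \<open>lam\<close> determines the degree \<open>n = sum_list lam\<close>.\<close>

definition J_of :: "nat list \<Rightarrow> (nat \<Rightarrow> nat) set" where
  "J_of lam = cox_gens (sum_list lam) -
     {transpose (sum_list (take k lam)) (sum_list (take k lam) + 1) |k. 1 \<le> k \<and> k < length lam}"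

definition W_of :: "nat list \<Rightarrow> (nat \<Rightarrow> nat) set" where
  "W_of lam = generate (symR (sum_list lam)) (J_of lam)"

definition longest_of :: "nat list \<Rightarrow> (nat \<Rightarrow> nat)" where
  "longest_of lam = (THE w. w \<in> W_of lam \<and>
     (\<forall>v\<in>W_of lam. cox_length (sum_list lam) v \<le> cox_length (sum_list lam) w))"

definition X_of :: "nat list \<Rightarrow> (nat \<Rightarrow> nat) set" where
  "X_of lam = {d \<in> carrier (symR (sum_list lam)).
     \<forall>x \<in> W_of lam #>\<^bsub>symR (sum_list lam)\<^esub> d.
       cox_length (sum_list lam) d \<le> cox_length (sum_list lam) x}"


section \<open>Robinson-Schensted correspondence and right cells\<close>

text \<open>Tableaux are lists of rows. \<open>rs_insert P Q x k\<close> row-inserts the entry \<open>x\<close> into the first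
  tableau: \<open>x\<close> replaces the leftmost larger entry of the current row, which is then inserted
  into the next row, or is appended to the row if there is no larger entry. The box that
  is added to the shape is labelled \<open>k\<close> in the second tableau.\<close>

fun rs_insert :: "nat list list \<Rightarrow> nat list list \<Rightarrow> nat \<Rightarrow> nat \<Rightarrow> nat list list \<times> nat list list" where
  "rs_insert (p # P) (q # Q) x k =
     (case dropWhile (\<lambda>y. y < x) p of
        [] \<Rightarrow> ((p @ [x]) # P, (q @ [k]) # Q)
      | y # ys \<Rightarrow>
          (let (P', Q') = rs_insert P Q y k
           in ((takeWhile (\<lambda>z. z < x) p @ x # ys) # P', q # Q')))"
| "rs_insert _ _ x k = ([[x]], [[k]])"

definition rs_pair :: "nat list \<Rightarrow> nat list list \<times> nat list list" where
  "rs_pair xs = fold (\<lambda>(x, k) (P, Q). rs_insert P Q x k) (zip xs [1..<length xs + 1]) ([], [])"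

definition row_form :: "nat \<Rightarrow> (nat \<Rightarrow> nat) \<Rightarrow> nat list" where
  "row_form n w = map w [1..<n + 1]"

definition recording_tableau :: "nat \<Rightarrow> (nat \<Rightarrow> nat) \<Rightarrow> nat list list" where
  "recording_tableau n w = snd (rs_pair (row_form n w))"

text \<open>The Kazhdan-Lusztig right cell equivalence on the symmetric group, in its explicit
  description by recording tableaux (for the right action and row-forms).\<close>

definition right_cell_equiv :: "nat \<Rightarrow> (nat \<Rightarrow> nat) \<Rightarrow> (nat \<Rightarrow> nat) \<Rightarrow> bool" where
  "right_cell_equiv n w w' \<longleftrightarrow> recording_tableau n w = recording_tableau n w'"

definition Z_of :: "nat list \<Rightarrow> (nat \<Rightarrow> nat) set" where
  "Z_of lam = {e \<in> X_of lam.
     right_cell_equiv (sum_list lam)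
       (longest_of lam \<otimes>\<^bsub>symR (sum_list lam)\<^esub> e) (longest_of lam)}"

definition Y_of :: "nat list \<Rightarrow> (nat \<Rightarrow> nat) set" where
  "Y_of lam = {x \<in> Z_of lam. \<not> (\<exists>y\<in>Z_of lam. y \<noteq> x \<and> cox_prefix (sum_list lam) x y)}"


section \<open>Diagrams\<close>

text \<open>A node is a pair (row index, column index). Since rows and columns are indexed
  consecutively from 1, all coordinates are positive and natural numbers suffice.\<close>

type_synonym node = "nat \<times> nat"

definition diagram :: "node set \<Rightarrow> bool" where
  "diagram D \<longleftrightarrow> finite D \<and> D \<noteq> {} \<and> (\<exists>r c. fst ` D = {1..r} \<and> snd ` D = {1..c})"

definition num_cols :: "node set \<Rightarrow> nat" where
  "num_cols D = card (snd ` D)"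

definition diagrams_of :: "nat list \<Rightarrow> node set set" where
  "diagrams_of lam = {D. diagram D \<and> fst ` D = {1..length lam} \<and>
     (\<forall>k\<in>{1..length lam}. card {x \<in> D. fst x = k} = lam ! (k - 1))}"

text \<open>The entry of a node in the filling by rows (by columns) is its position in the
  reading order.\<close>

definition row_filling :: "node set \<Rightarrow> node \<Rightarrow> nat" where
  "row_filling D x =
     card {y \<in> D. fst y < fst x \<or> (fst y = fst x \<and> snd y \<le> snd x)}"

definition col_filling :: "node set \<Rightarrow> node \<Rightarrow> nat" where
  "col_filling D x =
     card {y \<in> D. snd y < snd x \<or> (snd y = snd x \<and> fst y \<le> fst x)}"

definition w_of :: "node set \<Rightarrow> (nat \<Rightarrow> nat)" where
  "w_of D = (THE w. w \<in> carrier (symR (card D)) \<and>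
     (\<forall>x\<in>D. w (row_filling D x) = col_filling D x))"

definition D_of :: "(nat \<Rightarrow> nat) \<Rightarrow> nat list \<Rightarrow> node set" where
  "D_of d lam = (THE D. D \<in> diagrams_of lam \<and> w_of D = d \<and>
     (\<forall>E\<in>diagrams_of lam. w_of E = d \<longrightarrow> num_cols D \<le> num_cols E))"

definition young_diagram :: "nat list \<Rightarrow> node set" where
  "young_diagram mu = {(a, b). 1 \<le> a \<and> a \<le> length mu \<and> 1 \<le> b \<and> b \<le> mu ! (a - 1)}"

definition is_partition :: "nat list \<Rightarrow> bool" where
  "is_partition mu \<longleftrightarrow> mu \<noteq> [] \<and> (\<forall>m\<in>set mu. 0 < m) \<and> sorted_wrt (\<ge>) mu"

definition special :: "node set \<Rightarrow> bool" where
  "special D \<longleftrightarrow> (\<exists>mu \<sigma> \<tau>. is_partition mu \<and>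
     \<sigma> permutes fst ` young_diagram mu \<and> \<tau> permutes snd ` young_diagram mu \<and>
     D = (\<lambda>(a, b). (\<sigma> a, \<tau> b)) ` young_diagram mu)"

definition E_of :: "nat list \<Rightarrow> node set set" where
  "E_of lam = {D_of y lam |y. y \<in> Y_of lam}"

definition Es_of :: "nat list \<Rightarrow> node set set" where
  "Es_of lam = {D \<in> E_of lam. special D}"


section \<open>The composition \<open>(1, 2, \<dots>, 2, 1)\<close> and its diagrams\<close>

definition lam_of :: "nat \<Rightarrow> nat list" where
  "lam_of r = [1] @ replicate (r - 2) 2 @ [1]"

lemma is_composition_lam_of: "3 \<le> r \<Longrightarrow> is_composition (2 * r - 2) (lam_of r)"
  by (auto simp: is_composition_def lam_of_def sum_list_replicate)

definition P_diag :: "nat \<Rightarrow> nat \<Rightarrow> node set" where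
  "P_diag r v =
     (if v = 0 then
        {(i, 1) |i. 1 \<le> i \<and> i \<le> r} \<union> {(i, 2) |i. 2 \<le> i \<and> i \<le> r - 1}
      else if v = r - 2 then
        {(i, 1) |i. 2 \<le> i \<and> i \<le> r - 1} \<union> {(i, 2) |i. 1 \<le> i \<and> i \<le> r}
      else
        {(i, 1) |i. 2 \<le> i \<and> i \<le> v + 1} \<union> {(i, 2) |i. 1 \<le> i \<and> i \<le> r}
          \<union> {(i, 3) |i. v + 2 \<le> i \<and> i \<le> r - 1})"

end

theory Submission
  imports Defs
begin

text \<open>
  Write \<open>a k = e (2k)\<close> for \<open>1 \<le> k \<le> r - 1\<close> and \<open>b k = e (2k + 1)\<close> for \<open>0 \<le> k \<le> r - 2\<close>. The blocks of
  the composition carry the entries \<open>b 0\<close>, then \<open>a k, b k\<close> for \<open>1 \<le> k \<le> r - 2\<close>, then \<open>a (r - 1)\<close>.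
  A minimal coset representative \<open>e\<close> has \<open>a k < b k\<close>, and multiplying by the longest element of
  the parabolic subgroup gives the row-form \<open>b 0, b 1, a 1, b 2, a 2, \<dots>, a (r - 1)\<close>.

  The recording tableau of the longest element says that, in the insertion of this word, each
  \<open>b k\<close> and the last letter extend the first row, while each other \<open>a k\<close> bumps an entry to the
  end of the second row. Following the insertion, with an explicit formula for the tableau
  (\<open>rs_pair_group_word\<close>), shows that this happens precisely if \<open>a 1 < \<dots> < a (r - 1)\<close>,
  \<open>b 0 < \<dots> < b (r - 2)\<close> and \<open>b v < a (v + 1)\<close> for some \<open>v \<le> r - 2\<close> (\<open>Z_of_lam_of\<close>).

  The prefix order is containment of inversion sets (\<open>cox_prefix_iff\<close>). For a fixed \<open>v\<close>, every
  pair of positions that the permutation \<open>pperm r v\<close> of \<open>P_diag r v\<close> leaves in order is forced to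
  be in order by the listed relations, so \<open>pperm r v\<close> has the largest inversion set among the
  \<open>e\<close> satisfying them (\<open>Invs_pperm_maximal\<close>). These \<open>r - 1\<close> permutations are pairwise incomparable, because
  the relation \<open>b u < a (u + 1)\<close> holds in \<open>pperm r v\<close> only for \<open>u = v\<close>. Hence they are the
  maximal elements (\<open>Y_of_lam_of\<close>).

  A diagram for \<open>pperm r v\<close> must start a new column wherever the row index fails to increase in
  the reading by columns; \<open>P_diag r v\<close> has no further columns and is therefore the minimal
  diagram (\<open>minimal_diagram\<close>). It is special for \<open>v = 0\<close> and \<open>v = r - 2\<close>, and in
  the remaining cases it has two disjoint columns, which cannot happen in a special diagram
  (\<open>special_nested\<close>).
\<close>

section \<open>Inversions, length and the prefix order\<close>

text \<open>The inversion set of a permutation: the pairs of positions whose entries are out of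
  order in the row-form.\<close>

definition Invs :: "nat \<Rightarrow> (nat \<Rightarrow> nat) \<Rightarrow> (nat \<times> nat) set" where
  "Invs n w = {(i, j). 1 \<le> i \<and> i < j \<and> j \<le> n \<and> w j < w i}"

lemma finite_Invs [simp]: "finite (Invs n w)"
  by (rule finite_subset[of _ "{1..n} \<times> {1..n}"]) (auto simp: Invs_def)

text \<open>The inversions of \<open>z\<close> pulled back along \<open>x\<close>: the pairs \<open>i < j\<close> such that the unordered
  pair \<open>{x i, x j}\<close> is inverted by \<open>z\<close>. For \<open>x i > x j\<close> the equivalence below says that
  \<open>z (x i) \<le> z (x j)\<close>, which for injective \<open>z\<close> is a strict inequality.\<close>

definition pulled_Invs :: "nat \<Rightarrow> (nat \<Rightarrow> nat) \<Rightarrow> (nat \<Rightarrow> nat) \<Rightarrow> (nat \<times> nat) set" where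
  "pulled_Invs n x z = {(i, j). 1 \<le> i \<and> i < j \<and> j \<le> n \<and> (x i < x j \<longleftrightarrow> z (x j) < z (x i))}"

lemma finite_pulled_Invs [simp]: "finite (pulled_Invs n x z)"
  by (rule finite_subset[of _ "{1..n} \<times> {1..n}"]) (auto simp: pulled_Invs_def)

lemma card_pulled_Invs:
  assumes x: "x permutes {1..n}" and z: "z permutes {1..n}"
  shows "card (pulled_Invs n x z) = card (Invs n z)"
proof -
  define g where "g = (\<lambda>(i, j). (min (x i) (x j), max (x i) (x j)))"
  define h where "h = (\<lambda>(i, j). (min (inv_into UNIV x i) (inv_into UNIV x j), max (inv_into UNIV x i) (inv_into UNIV x j)))"
  have ix: "inv_into UNIV x permutes {1..n}" by (rule permutes_inv[OF x])
  have xi: "x (inv_into UNIV x i) = i" "inv_into UNIV x (x i) = i" for i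
    using permutes_inverses[OF x] by auto
  have xr: "1 \<le> x i" "x i \<le> n" if "1 \<le> i" "i \<le> n" for i
    using permutes_in_image[OF x, of i] that by auto
  have ir: "1 \<le> inv_into UNIV x i" "inv_into UNIV x i \<le> n" if "1 \<le> i" "i \<le> n" for i
    using permutes_in_image[OF ix, of i] that by auto
  have ne: "x i \<noteq> x j" "z i \<noteq> z j" "inv_into UNIV x i \<noteq> inv_into UNIV x j" if "i \<noteq> j" for i j
    using permutes_inj[OF x] permutes_inj[OF z] permutes_inj[OF ix] that
    by (auto simp: inj_eq)
  have "bij_betw g (pulled_Invs n x z) (Invs n z)"
  proof (rule bij_betw_byWitness[where f' = h])
    show "\<forall>p\<in>pulled_Invs n x z. h (g p) = p"
      by (auto simp: pulled_Invs_def g_def h_def xi min_def max_def)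
    show "\<forall>q\<in>Invs n z. g (h q) = q"
      by (auto simp: Invs_def g_def h_def xi min_def max_def)
    show "g ` pulled_Invs n x z \<subseteq> Invs n z"
    proof (rule image_subsetI)
      fix q assume "q \<in> pulled_Invs n x z"
      then obtain i j where q: "q = (i, j)" and p: "1 \<le> i" "i < j" "j \<le> n" "x i < x j \<longleftrightarrow> z (x j) < z (x i)"
        by (auto simp: pulled_Invs_def)
      show "g q \<in> Invs n z"
        unfolding q using p ne[of i j] ne[of "x i" "x j"] xr[of i] xr[of j]
        by (cases "x i < x j") (auto simp: g_def Invs_def min_def max_def)
    qed
    show "h ` Invs n z \<subseteq> pulled_Invs n x z"
    proof (rule image_subsetI)
      fix q assume "q \<in> Invs n z"
      then obtain i j where q: "q = (i, j)" and p: "1 \<le> i" "i < j" "j \<le> n" "z j < z i"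
        by (auto simp: Invs_def)
      show "h q \<in> pulled_Invs n x z"
        unfolding q using p ne[of i j] ir[of i] ir[of j]
        by (cases "inv_into UNIV x i < inv_into UNIV x j") (auto simp: h_def pulled_Invs_def min_def max_def xi)
    qed
  qed
  then show ?thesis by (rule bij_betw_same_card)
qed

text \<open>A pair is inverted by the product of \<open>x\<close> and \<open>z\<close> exactly when it is reversed an odd
  number of times, so the inversion set of a product is a symmetric difference. Length
  additivity then means that the two sets are disjoint, that is, that the inversions of \<open>x\<close>
  survive in the product. This gives both the length formula and the description of prefixes.\<close>

lemma Invs_comp:
  assumes x: "x permutes {1..n}" and z: "z permutes {1..n}"
  shows "Invs n (z \<circ> x) = (Invs n x - pulled_Invs n x z) \<union> (pulled_Invs n x z - Invs n x)"
proof -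
  have ne: "x i \<noteq> x j" "z i \<noteq> z j" if "i \<noteq> j" for i j
    using permutes_inj[OF x] permutes_inj[OF z] that by (auto simp: inj_eq)
  have "p \<in> Invs n (z \<circ> x) \<longleftrightarrow> (p \<in> Invs n x) \<noteq> (p \<in> pulled_Invs n x z)" for p
  proof (cases p)
    case (Pair i j)
    show ?thesis
      unfolding Pair Invs_def pulled_Invs_def using ne[of i j] ne[of "x i" "x j"]
      by (cases "i < j") auto
  qed
  then show ?thesis by auto
qed

lemma card_Invs_comp:
  assumes "x permutes {1..n}" and "z permutes {1..n}"
  shows "card (Invs n (z \<circ> x)) + 2 * card (Invs n x \<inter> pulled_Invs n x z)
    = card (Invs n x) + card (Invs n z)"
proof -
  let ?A = "Invs n x" and ?B = "pulled_Invs n x z"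
  have "card (Invs n (z \<circ> x)) = card (?A - ?B) + card (?B - ?A)"
    unfolding Invs_comp[OF assms] by (rule card_Un_disjoint) auto
  moreover have "card (?A - ?B) + card (?A \<inter> ?B) = card ?A"
    by (metis add.commute card_Int_Diff finite_Invs)
  moreover have "card (?B - ?A) + card (?A \<inter> ?B) = card ?B"
    by (metis Int_commute add.commute card_Int_Diff finite_pulled_Invs)
  ultimately show ?thesis
    using card_pulled_Invs[OF assms] by simp
qed

lemma Invs_inject:
  assumes x: "x permutes {1..n}" and y: "y permutes {1..n}" and eq: "Invs n x = Invs n y"
  shows "x = y"
proof -
  define z where "z = y \<circ> inv_into UNIV x"
  have z: "z permutes {1..n}"
    unfolding z_def by (rule permutes_compose[OF permutes_inv[OF x] y])
  have yz: "y = z \<circ> x"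
    unfolding z_def using permutes_inv_o[OF x] by (simp add: comp_assoc)
  have "pulled_Invs n x z = {}"
    using Invs_comp[OF x z] eq yz by auto
  then have none: "Invs n z = {}"
    using card_pulled_Invs[OF x z] by simp
  have le: "z i \<le> z j" if "1 \<le> i" "i < j" "j \<le> n" for i j
  proof (rule ccontr)
    assume "\<not> z i \<le> z j"
    then have "(i, j) \<in> Invs n z" using that by (simp add: Invs_def)
    then show False using none by simp
  qed
  have "strict_mono_on {1..n} z"
  proof (rule strict_mono_onI)
    fix i j assume "i \<in> {1..n}" "j \<in> {1..n}" "i < j"
    then show "z i < z j"
      using le[of i j] permutes_inj[OF z] by (auto simp: inj_eq le_less)
  qed
  \<comment> \<open>An increasing permutation of an initial segment maps each initial segment to one.\<close>
  have "z i = i" if "i \<in> {1..n}" for i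
  proof -
    have "z ` {1..i} = {1..z i}"
    proof safe
      fix k assume "k \<in> {1..i}"
      then show "z k \<in> {1..z i}"
        using le[of k i] that permutes_in_image[OF z, of k] by (cases "k = i") auto
    next
      fix t assume t: "t \<in> {1..z i}"
      then have "t \<in> {1..n}" using permutes_in_image[OF z, of i] that by auto
      then obtain k where k: "k \<in> {1..n}" "t = z k"
        using permutes_image[OF z] by blast
      have "k \<le> i"
        using t k \<open>strict_mono_on {1..n} z\<close> that
        by (meson atLeastAtMost_iff leD leI strict_mono_onD)
      then show "t \<in> z ` {1..i}" using k by auto
    qed
    then have "card {1..z i} = card {1..i}"
      using card_image[of z "{1..i}"] permutes_inj[OF z] by (metis inj_on_subset subset_UNIV)
    then show ?thesis by simp
  qed
  then have "z = id"
    using permutes_not_in[OF z] by (auto simp: fun_eq_iff)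
  then show ?thesis using yz by simp
qed

lemma Invs_transpose:
  assumes "1 \<le> i" and "i < n"
  shows "Invs n (transpose i (i + 1)) = {(i, i + 1)}"
  using assms by (auto simp: Invs_def transpose_def split: if_splits)

lemma transpose_permutes:
  fixes i n :: nat
  assumes "1 \<le> i" and "i < n"
  shows "transpose i (i + 1) permutes {1..n}"
  using assms by (intro permutes_swap_id) auto

lemma card_Invs_swap:
  assumes w: "w permutes {1..n}" and i: "1 \<le> i" "i < n" and descent: "w (i + 1) < w i"
  shows "card (Invs n w) = card (Invs n (w \<circ> transpose i (i + 1))) + 1"
proof -
  let ?s = "transpose i (i + 1)"
  have "card (Invs n (w \<circ> ?s)) + 2 * card ({(i, i + 1)} \<inter> pulled_Invs n ?s w)
    = 1 + card (Invs n w)"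
    using card_Invs_comp[OF transpose_permutes[OF i] w] unfolding Invs_transpose[OF i] by simp
  moreover have "(i, i + 1) \<in> pulled_Invs n ?s w"
    using i descent by (auto simp: pulled_Invs_def transpose_def)
  ultimately show ?thesis by simp
qed

lemma Invs_id [simp]: "Invs n id = {}"
  by (auto simp: Invs_def)

lemma word_prod_Nil [simp]: "word_prod n [] = id"
  and word_prod_Cons [simp]: "word_prod n (s # ws) = word_prod n ws \<circ> s"
  by (simp_all add: word_prod_def symR_def)

lemma word_prod_append: "word_prod n (us @ vs) = word_prod n vs \<circ> word_prod n us"
  by (induction us) (simp_all add: comp_assoc)

lemma word_prod_permutes: "set ws \<subseteq> cox_gens n \<Longrightarrow> word_prod n ws permutes {1..n}"
proof (induction ws)
  case Nil
  then show ?case using permutes_id[of "{1..n}"] by (simp add: id_def)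
next
  case (Cons s ws)
  then have "s permutes {1..n}"
    using transpose_permutes by (auto simp: cox_gens_def)
  then show ?case
    unfolding word_prod_Cons by (rule permutes_compose) (use Cons in auto)
qed

lemma card_Invs_word_prod: "set ws \<subseteq> cox_gens n \<Longrightarrow> card (Invs n (word_prod n ws)) \<le> length ws"
proof (induction ws)
  case (Cons s ws)
  then obtain i where i: "s = transpose i (i + 1)" "1 \<le> i" "i < n"
    by (auto simp: cox_gens_def)
  let ?w = "word_prod n ws"
  have w: "?w permutes {1..n}" using Cons by (intro word_prod_permutes) auto
  have "card (Invs n (?w \<circ> s)) + 2 * card (Invs n s \<inter> pulled_Invs n s ?w) = 1 + card (Invs n ?w)"
    using card_Invs_comp[OF transpose_permutes[OF i(2,3)] w] i Invs_transpose[OF i(2,3)]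
    by simp
  then have "card (Invs n (?w \<circ> s)) \<le> 1 + card (Invs n ?w)" by linarith
  also have "\<dots> \<le> length (s # ws)" using Cons by simp
  finally show ?case by (simp only: word_prod_Cons)
qed (simp add: Invs_id[unfolded id_def])

text \<open>Bubble sort: removing a descent lowers the number of inversions by one.\<close>

lemma exists_word:
  assumes "w permutes {1..n}"
  shows "\<exists>ws. expression_of n ws w \<and> length ws = card (Invs n w)"
  using assms
proof (induction "card (Invs n w)" arbitrary: w)
  case 0
  then have "Invs n w = Invs n id" by simp
  then have "w = id" using Invs_inject 0 permutes_id by blast
  then have "expression_of n [] w" by (simp add: expression_of_def)
  then show ?case using 0 by (metis list.size(3))
next
  case (Suc m)
  have "\<exists>i. 1 \<le> i \<and> i < n \<and> w (i + 1) < w i"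
  proof (rule ccontr)
    assume no: "\<not> ?thesis"
    have mono: "w i \<le> w j" if "1 \<le> i" "i \<le> j" "j \<le> n" for i j
      using that(2,1,3)
    proof (induction j rule: dec_induct)
      case (step k)
      have "1 \<le> k" "k < n" using step by auto
      then have "w k \<le> w (k + 1)" using no by (meson leI)
      then show ?case using step by simp
    qed simp
    have "Invs n w = {}"
    proof (rule equals0I)
      fix p assume "p \<in> Invs n w"
      then show False using mono[of "fst p" "snd p"] by (auto simp: Invs_def)
    qed
    then show False using Suc by simp
  qed
  then obtain i where i: "1 \<le> i" "i < n" "w (i + 1) < w i" by blast
  let ?s = "transpose i (i + 1)"
  have p: "w \<circ> ?s permutes {1..n}"
    by (rule permutes_compose[OF transpose_permutes[OF i(1,2)] Suc.prems])
  have "m = card (Invs n (w \<circ> ?s))"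
    using card_Invs_swap[OF Suc.prems i] Suc.hyps(2) by simp
  then obtain ws where ws: "expression_of n ws (w \<circ> ?s)" "length ws = card (Invs n (w \<circ> ?s))"
    using Suc.hyps(1) p by blast
  have "expression_of n (?s # ws) w"
    using ws i by (auto simp: expression_of_def cox_gens_def comp_assoc)
  then show ?case
    using ws \<open>m = _\<close> Suc.hyps(2) by (metis length_Cons)
qed

lemma cox_length_eq:
  assumes "w permutes {1..n}"
  shows "cox_length n w = card (Invs n w)"
  unfolding cox_length_def
proof (rule Least_equality)
  show "\<exists>ws. expression_of n ws w \<and> length ws = card (Invs n w)"
    by (rule exists_word[OF assms])
  show "card (Invs n w) \<le> k" if "\<exists>ws. expression_of n ws w \<and> length ws = k" for k
    using that card_Invs_word_prod by (auto simp: expression_of_def)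
qed

text \<open>The prefix order is the weak order, given by containment of inversion sets.\<close>

lemma cox_prefix_iff:
  assumes x: "x permutes {1..n}" and y: "y permutes {1..n}"
  shows "cox_prefix n x y \<longleftrightarrow> Invs n x \<subseteq> Invs n y"
proof
  assume "cox_prefix n x y"
  then obtain us vs where r: "reduced_expression_of n us x" "reduced_expression_of n (us @ vs) y"
    by (auto simp: cox_prefix_def)
  define z where "z = word_prod n vs"
  have gens: "set us \<subseteq> cox_gens n" "set vs \<subseteq> cox_gens n" and yz: "y = z \<circ> x"
    using r by (auto simp: reduced_expression_of_def expression_of_def word_prod_append z_def)
  have z: "z permutes {1..n}" unfolding z_def by (rule word_prod_permutes[OF gens(2)])
  have "card (Invs n x) + card (Invs n z) \<le> card (Invs n y)"
    using r card_Invs_word_prod[OF gens(2)]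
    by (simp add: reduced_expression_of_def cox_length_eq[OF x] cox_length_eq[OF y] z_def)
  then have "card (Invs n x \<inter> pulled_Invs n x z) = 0"
    using card_Invs_comp[OF x z] unfolding yz by linarith
  then have "Invs n x \<inter> pulled_Invs n x z = {}" by simp
  then show "Invs n x \<subseteq> Invs n y"
    unfolding yz Invs_comp[OF x z] by auto
next
  assume sub: "Invs n x \<subseteq> Invs n y"
  define z where "z = y \<circ> inv_into UNIV x"
  have z: "z permutes {1..n}"
    unfolding z_def by (rule permutes_compose[OF permutes_inv[OF x] y])
  have yz: "y = z \<circ> x"
    unfolding z_def using permutes_inv_o[OF x] by (simp add: comp_assoc)
  have "Invs n x \<inter> pulled_Invs n x z = {}"
    using sub unfolding yz Invs_comp[OF x z] by auto
  then have len: "card (Invs n y) = card (Invs n x) + card (Invs n z)"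
    using card_Invs_comp[OF x z] yz by simp
  obtain us vs where us: "expression_of n us x" "length us = card (Invs n x)"
    and vs: "expression_of n vs z" "length vs = card (Invs n z)"
    using exists_word x z by metis
  have "reduced_expression_of n us x" "reduced_expression_of n (us @ vs) y"
    using us vs len yz cox_length_eq[OF x] cox_length_eq[OF y]
    by (simp_all add: reduced_expression_of_def expression_of_def word_prod_append)
  then show "cox_prefix n x y" by (auto simp: cox_prefix_def)
qed

section \<open>The parabolic subgroup of the composition \<open>(1, 2, \<dots>, 2, 1)\<close>\<close>

lemma length_lam_of: "3 \<le> r \<Longrightarrow> length (lam_of r) = r"
  by (simp add: lam_of_def)

lemma sum_take_lam_of:
  assumes "3 \<le> r" and "k \<le> r"
  shows "sum_list (take k (lam_of r)) = (if k = 0 then 0 else if k < r then 2 * k - 1 else 2 * r - 2)"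
proof -
  consider "k = 0" | "1 \<le> k" "k < r" | "k = r" using assms by linarith
  then show ?thesis
  proof cases
    case 2
    then have "take k (lam_of r) = 1 # replicate (k - 1) 2"
      using assms by (cases k) (auto simp: lam_of_def min_def)
    then show ?thesis using 2 by (simp add: sum_list_replicate)
  next
    case 3
    then show ?thesis using assms by (auto simp: lam_of_def sum_list_replicate)
  qed simp
qed

lemma sum_list_lam_of: "3 \<le> r \<Longrightarrow> sum_list (lam_of r) = 2 * r - 2"
  using sum_take_lam_of[of r r] length_lam_of[of r] by simp

lemma transpose_adjacent_inject:
  fixes i j :: nat
  assumes "transpose i (i + 1) = transpose j (j + 1)"
  shows "i = j"
  using fun_cong[OF assms, of i] by (auto simp: transpose_def split: if_splits)

lemma J_of_lam_of:
  assumes r: "3 \<le> r"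
  shows "J_of (lam_of r) = {transpose (2 * k) (2 * k + 1) |k. 1 \<le> k \<and> k \<le> r - 2}"
proof -
  have J: "J_of (lam_of r) = cox_gens (2 * r - 2) - {transpose (2 * k - 1) (2 * k - 1 + 1) |k. 1 \<le> k \<and> k < r}"
  proof -
    have "sum_list (take k (lam_of r)) = 2 * k - 1" if "1 \<le> k" "k < r" for k
      using sum_take_lam_of[OF r, of k] that by simp
    then show ?thesis
      unfolding J_of_def sum_list_lam_of[OF r] length_lam_of[OF r] by (metis (lifting))
  qed
  show ?thesis
  proof (intro equalityI subsetI)
    fix s assume "s \<in> J_of (lam_of r)"
    then obtain i where i: "s = transpose i (i + 1)" "1 \<le> i" "i < 2 * r - 2"
      and n: "\<not> (\<exists>k. s = transpose (2 * k - 1) (2 * k - 1 + 1) \<and> 1 \<le> k \<and> k < r)"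
      unfolding J cox_gens_def by blast
    have "even i"
    proof (rule ccontr)
      assume "odd i"
      then have "2 * (Suc (i div 2)) - 1 = i" by presburger
      moreover have "1 \<le> Suc (i div 2)" "Suc (i div 2) < r" using i by auto
      ultimately show False using n i(1) by metis
    qed
    then show "s \<in> {transpose (2 * k) (2 * k + 1) |k. 1 \<le> k \<and> k \<le> r - 2}"
      using i by (intro CollectI exI[of _ "i div 2"]) auto
  next
    fix s assume "s \<in> {transpose (2 * k) (2 * k + 1) |k. 1 \<le> k \<and> k \<le> r - 2}"
    then obtain k where k: "s = transpose (2 * k) (2 * k + 1)" "1 \<le> k" "k \<le> r - 2" by blast
    have "s \<in> cox_gens (2 * r - 2)"
      using k unfolding cox_gens_def by (intro CollectI exI[of _ "2 * k"]) auto
    moreover have "s \<noteq> transpose (2 * l - 1) (2 * l - 1 + 1)" if "1 \<le> l" for l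
      using transpose_adjacent_inject[of "2 * k" "2 * l - 1"] that k by (auto; presburger)
    ultimately show "s \<in> J_of (lam_of r)" unfolding J by blast
  qed
qed

lemma symR_simps: "carrier (symR n) = {p. p permutes {1..n}}" "x \<otimes>\<^bsub>symR n\<^esub> y = y \<circ> x" "\<one>\<^bsub>symR n\<^esub> = id"
  by (simp_all add: symR_def)

lemma inv_symR_involution:
  assumes "s permutes {1..n}" and "s \<circ> s = id"
  shows "inv\<^bsub>symR n\<^esub> s = s"
  unfolding m_inv_def symR_simps
proof (rule the_equality)
  show "s \<in> {p. p permutes {1..n}} \<and> s \<circ> s = id \<and> s \<circ> s = id" using assms by simp
  fix y assume "y \<in> {p. p permutes {1..n}} \<and> y \<circ> s = id \<and> s \<circ> y = id"
  then show "y = s" using assms(2) by (metis comp_assoc comp_id id_comp)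
qed

text \<open>The permutation interchanging \<open>2k\<close> and \<open>2k + 1\<close> for \<open>1 \<le> k \<le> m\<close>. The blocks of the composition
  \<open>(1, 2, \<dots>, 2, 1)\<close> are the fibres of \<open>i \<mapsto> i div 2\<close>, so for \<open>m = r - 2\<close> this reverses every
  block.\<close>

definition block_swap :: "nat \<Rightarrow> nat \<Rightarrow> nat" where
  "block_swap m i = (if 2 \<le> i \<and> i \<le> 2 * m + 1 then if even i then i + 1 else i - 1 else i)"

lemma W_of_lam_of_D:
  assumes r: "3 \<le> r" and w: "w \<in> W_of (lam_of r)"
  shows "w permutes {1..2 * r - 2} \<and> (\<forall>i. w i div 2 = i div 2)"
proof -
  have J: "s permutes {1..2 * r - 2} \<and> (\<forall>i. s i div 2 = i div 2) \<and> s \<circ> s = id"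
    if "s \<in> J_of (lam_of r)" for s
  proof -
    from that obtain k where k: "s = transpose (2 * k) (2 * k + 1)" "1 \<le> k" "k \<le> r - 2"
      unfolding J_of_lam_of[OF r] by blast
    have "s permutes {1..2 * r - 2}"
      unfolding k(1) by (rule transpose_permutes) (use k in auto)
    moreover have "s i div 2 = i div 2" for i
      unfolding k(1) by (auto simp: transpose_def)
    ultimately show ?thesis unfolding k(1) by simp
  qed
  from w show ?thesis
    unfolding W_of_def sum_list_lam_of[OF r]
  proof (induction rule: generate.induct)
    case one
    then show ?case using permutes_id[of "{1..2 * r - 2}"] by (simp only: symR_simps) simp
  next
    case (incl h)
    then show ?case using J by blast
  next
    case (inv h)
    then show ?case using J inv_symR_involution by metis
  next
    case (eng h1 h2)
    then show ?case
      unfolding symR_simps using permutes_compose[of h1 "{1..2 * r - 2}" h2] by (simp add: comp_def)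
  qed
qed

lemma block_swap_in_W_of:
  assumes r: "3 \<le> r"
  shows "m \<le> r - 2 \<Longrightarrow> block_swap m \<in> W_of (lam_of r)"
proof (induction m)
  case 0
  have "block_swap 0 = \<one>\<^bsub>symR (sum_list (lam_of r))\<^esub>"
    by (auto simp: block_swap_def symR_simps fun_eq_iff)
  then show ?case unfolding W_of_def using generate.one by metis
next
  case (Suc m)
  let ?s = "transpose (2 * Suc m) (2 * Suc m + 1)"
  have "?s \<in> J_of (lam_of r)" unfolding J_of_lam_of[OF r] using Suc.prems by fastforce
  then have "?s \<otimes>\<^bsub>symR (sum_list (lam_of r))\<^esub> block_swap m \<in> W_of (lam_of r)"
    using Suc unfolding W_of_def by (intro generate.eng[OF generate.incl]) auto
  also have "?s \<otimes>\<^bsub>symR (sum_list (lam_of r))\<^esub> block_swap m = block_swap (Suc m)"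
    unfolding symR_simps by (rule ext) (auto simp: block_swap_def transpose_def; presburger)
  finally show ?case .
qed

lemma Invs_block_preserving:
  assumes "\<forall>i. w i div 2 = i div 2" and "(i, j) \<in> Invs n w"
  shows "even i \<and> j = i + 1"
proof -
  from assms(2) have ij: "i < j" "w j < w i" by (auto simp: Invs_def)
  have "j div 2 \<le> i div 2" using assms(1) ij(2) by (metis div_le_mono less_imp_le)
  then show ?thesis using ij(1) by presburger
qed

lemma Invs_block_swap:
  "Invs (2 * m + 2) (block_swap m) = {(i, j). 1 \<le> i \<and> even i \<and> j = i + 1 \<and> j \<le> 2 * m + 2}"
proof -
  have b: "\<forall>i. block_swap m i div 2 = i div 2" by (auto simp: block_swap_def; presburger)
  show ?thesis
  proof (intro equalityI subsetI)
    fix p assume p: "p \<in> Invs (2 * m + 2) (block_swap m)"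
    then show "p \<in> {(i, j). 1 \<le> i \<and> even i \<and> j = i + 1 \<and> j \<le> 2 * m + 2}"
      using Invs_block_preserving[OF b, of "fst p" "snd p"] by (auto simp: Invs_def)
  next
    fix p assume "p \<in> {(i, j). 1 \<le> i \<and> even i \<and> j = i + 1 \<and> j \<le> 2 * m + 2}"
    then obtain i where i: "p = (i, i + 1)" "1 \<le> i" "even i" "i + 1 \<le> 2 * m + 2" by auto
    then have "2 \<le> i" "i + 1 \<le> 2 * m + 1" by presburger+
    then show "p \<in> Invs (2 * m + 2) (block_swap m)"
      using i by (auto simp: Invs_def block_swap_def)
  qed
qed

lemma longest_of_lam_of:
  assumes r: "3 \<le> r"
  shows "longest_of (lam_of r) = block_swap (r - 2)"
proof -
  let ?n = "2 * r - 2" and ?w = "block_swap (r - 2)"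
  have n: "?n = 2 * (r - 2) + 2" using r by simp
  have wW: "?w \<in> W_of (lam_of r)" using block_swap_in_W_of[OF r] by simp
  note W = W_of_lam_of_D[OF r]
  have sub: "Invs ?n v \<subseteq> Invs ?n ?w" if "v \<in> W_of (lam_of r)" for v
  proof
    fix p assume p: "p \<in> Invs ?n v"
    then have "even (fst p) \<and> snd p = fst p + 1"
      using Invs_block_preserving[of v "fst p" "snd p" ?n] W[OF that] by simp
    then show "p \<in> Invs ?n ?w"
      using p unfolding n Invs_block_swap by (auto simp: Invs_def)
  qed
  have len: "cox_length ?n v = card (Invs ?n v)" if "v \<in> W_of (lam_of r)" for v
    using cox_length_eq W[OF that] by blast
  show ?thesis
    unfolding longest_of_def sum_list_lam_of[OF r]
  proof (rule the_equality)
    show "?w \<in> W_of (lam_of r) \<and> (\<forall>v\<in>W_of (lam_of r). cox_length ?n v \<le> cox_length ?n ?w)"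
      using wW len sub card_mono[OF finite_Invs] by auto
    fix w assume w: "w \<in> W_of (lam_of r) \<and> (\<forall>v\<in>W_of (lam_of r). cox_length ?n v \<le> cox_length ?n w)"
    then have "card (Invs ?n ?w) \<le> card (Invs ?n w)" using wW len by metis
    then have "Invs ?n w = Invs ?n ?w"
      using sub w by (intro card_seteq) auto
    then show "w = ?w" using Invs_inject W w wW by blast
  qed
qed

lemma half_eq_less:
  fixes x y k :: nat
  assumes "x < y" and "x div 2 = k" and "y div 2 = k"
  shows "x = 2 * k \<and> y = 2 * k + 1"
  using assms by presburger

text \<open>Minimal coset representatives are the permutations increasing on each block. If \<open>d\<close> is
  increasing on the blocks and \<open>w\<close> preserves them, an inversion of \<open>w\<close> is never a pulled back
  inversion of \<open>d\<close>, so the length of the product is the sum of the lengths.\<close>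

lemma X_of_lam_of:
  assumes r: "3 \<le> r"
  shows "d \<in> X_of (lam_of r) \<longleftrightarrow>
    d permutes {1..2 * r - 2} \<and> (\<forall>k. 1 \<le> k \<and> k \<le> r - 2 \<longrightarrow> d (2 * k) < d (2 * k + 1))"
    (is "_ \<longleftrightarrow> d permutes {1..?n} \<and> ?inc")
proof -
  have X: "d \<in> X_of (lam_of r) \<longleftrightarrow> d permutes {1..?n} \<and>
      (\<forall>w\<in>W_of (lam_of r). cox_length ?n d \<le> cox_length ?n (d \<circ> w))"
    by (auto simp: X_of_def r_coset_def symR_simps sum_list_lam_of[OF r])
  have len: "cox_length ?n (d \<circ> w) = card (Invs ?n (d \<circ> w))"
    if "d permutes {1..?n}" "w \<in> W_of (lam_of r)" for w
    using W_of_lam_of_D[OF r that(2)] permutes_compose that(1) cox_length_eq by blast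
  show ?thesis
    unfolding X
  proof (intro conj_cong refl iffI allI impI ballI)
    assume d: "d permutes {1..?n}"
    {
      fix k assume min: "\<forall>w\<in>W_of (lam_of r). cox_length ?n d \<le> cox_length ?n (d \<circ> w)"
        and k: "1 \<le> k \<and> k \<le> r - 2"
      let ?s = "transpose (2 * k) (2 * k + 1)"
      have s: "?s \<in> W_of (lam_of r)"
        unfolding W_of_def using k by (intro generate.incl) (auto simp: J_of_lam_of[OF r])
      show "d (2 * k) < d (2 * k + 1)"
      proof (rule ccontr)
        assume "\<not> ?thesis"
        moreover have "d (2 * k) \<noteq> d (2 * k + 1)" using permutes_inj[OF d] by (simp add: inj_eq)
        ultimately have "card (Invs ?n d) = card (Invs ?n (d \<circ> ?s)) + 1"
          using k by (intro card_Invs_swap[OF d]) auto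
        moreover have "cox_length ?n d \<le> cox_length ?n (d \<circ> ?s)" using min s by blast
        ultimately show False using len[OF d s] cox_length_eq[OF d] by simp
      qed
    }
    {
      fix w assume inc: ?inc and w: "w \<in> W_of (lam_of r)"
      note wD = W_of_lam_of_D[OF r w]
      have "Invs ?n w \<inter> pulled_Invs ?n w d = {}"
      proof (rule equals0I)
        fix p assume p: "p \<in> Invs ?n w \<inter> pulled_Invs ?n w d"
        define i where "i = fst p"
        have "p = (i, snd p)" by (simp add: i_def)
        moreover from this have "even i \<and> snd p = i + 1"
          using Invs_block_preserving[of w i "snd p" ?n] wD p by simp
        ultimately have ev: "even i" "p = (i, i + 1)" by simp_all
        then have inv: "w (i + 1) < w i" "1 \<le> i" "i + 1 \<le> ?n" and nlt: "\<not> d (w (i + 1)) < d (w i)"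
          using p by (auto simp: Invs_def pulled_Invs_def)
        have "w (i + 1) div 2 = i div 2" "w i div 2 = i div 2" using wD ev by auto
        then have "w (i + 1) = 2 * (i div 2) \<and> w i = 2 * (i div 2) + 1"
          by (intro half_eq_less inv(1))
        moreover have "1 \<le> i div 2" "i div 2 \<le> r - 2" using inv ev by auto
        ultimately show False using inc nlt by auto
      qed
      then show "cox_length ?n d \<le> cox_length ?n (d \<circ> w)"
        using card_Invs_comp[of w ?n d] wD d len[OF d w] cox_length_eq[OF d] by simp
    }
  qed
qed

section \<open>Recording tableaux of row insertion\<close>

lemma rs_pair_snoc:
  "rs_pair (xs @ [x]) = rs_insert (fst (rs_pair xs)) (snd (rs_pair xs)) x (length xs + 1)"
proof -
  have "[1..<length (xs @ [x]) + 1] = [1..<length xs + 1] @ [length xs + 1]" by simp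
  then show ?thesis
    unfolding rs_pair_def by (simp del: upt_Suc add: split_beta)
qed

text \<open>The part of well-formedness of a pair of tableaux after \<open>m\<close> insertions that is needed to
  undo an insertion: equally many rows, and non-empty rows of labels up to \<open>m\<close> in the second
  tableau.\<close>

definition tab_wf :: "nat \<Rightarrow> nat list list \<times> nat list list \<Rightarrow> bool" where
  "tab_wf m PQ \<longleftrightarrow> length (fst PQ) = length (snd PQ) \<and> (\<forall>q\<in>set (snd PQ). q \<noteq> [] \<and> (\<forall>i\<in>set q. i \<le> m))"

text \<open>Removing a label, and the row containing it if that becomes empty. This recovers the
  recording tableau of a word with its last letter deleted.\<close>

definition erase_label :: "nat \<Rightarrow> nat list list \<Rightarrow> nat list list" where
  "erase_label k Q = filter (\<lambda>q. q \<noteq> []) (map (filter (\<lambda>i. i \<noteq> k)) Q)"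

lemma filter_fresh: "k \<notin> set q \<Longrightarrow> filter (\<lambda>i. i \<noteq> k) q = q"
  by (induction q) auto

lemma erase_label_fresh: "\<forall>q\<in>set Q. q \<noteq> [] \<and> k \<notin> set q \<Longrightarrow> erase_label k Q = Q"
  unfolding erase_label_def by (induction Q) (auto simp: filter_fresh)

lemma erase_label_Cons:
  "erase_label k (q # Q) = (if filter (\<lambda>i. i \<noteq> k) q = [] then [] else [filter (\<lambda>i. i \<noteq> k) q]) @ erase_label k Q"
  by (simp add: erase_label_def)

lemma rs_insert_erase:
  assumes "length P = length Q" and "\<forall>q\<in>set Q. q \<noteq> [] \<and> k \<notin> set q"
  shows "erase_label k (snd (rs_insert P Q x k)) = Q"
  using assms
proof (induction Q arbitrary: P x)
  case Nil
  then show ?case by (simp add: erase_label_def)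
next
  case (Cons q Q)
  then obtain p P' where P: "P = p # P'" by (cases P) auto
  show ?case
  proof (cases "dropWhile (\<lambda>y. y < x) p")
    case Nil
    then have "rs_insert P (q # Q) x k = ((p @ [x]) # P', (q @ [k]) # Q)"
      unfolding P by (simp del: dropWhile_eq_Nil_conv)
    then show ?thesis using Cons.prems
      by (simp add: erase_label_Cons filter_fresh erase_label_fresh)
  next
    case C: (Cons y ys)
    have "erase_label k (snd (rs_insert P' Q y k)) = Q"
      by (rule Cons.IH) (use Cons.prems P in auto)
    then show ?thesis
      unfolding P using C Cons.prems(2) by (simp add: erase_label_Cons filter_fresh split_beta)
  qed
qed

lemma rs_insert_wf:
  assumes "length P = length Q" and "\<forall>q\<in>set Q. q \<noteq> [] \<and> (\<forall>i\<in>set q. i \<le> k)"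
  shows "tab_wf k (rs_insert P Q x k)"
  using assms
proof (induction Q arbitrary: P x)
  case Nil
  then show ?case by (simp add: tab_wf_def)
next
  case (Cons q Q)
  then obtain p P' where P: "P = p # P'" by (cases P) auto
  show ?case
  proof (cases "dropWhile (\<lambda>y. y < x) p")
    case Nil
    then have "rs_insert P (q # Q) x k = ((p @ [x]) # P', (q @ [k]) # Q)"
      unfolding P by (simp del: dropWhile_eq_Nil_conv)
    then show ?thesis using Cons.prems P by (auto simp: tab_wf_def)
  next
    case C: (Cons y ys)
    have "tab_wf k (rs_insert P' Q y k)"
      by (rule Cons.IH) (use Cons.prems P in auto)
    then show ?thesis
      unfolding P using C Cons.prems(2) by (simp add: tab_wf_def split_beta)
  qed
qed

lemma rs_pair_wf: "tab_wf (length xs) (rs_pair xs)"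
proof (induction xs rule: rev_induct)
  case Nil
  then show ?case by (simp add: rs_pair_def tab_wf_def)
next
  case (snoc x xs)
  then have "tab_wf (length xs + 1) (rs_insert (fst (rs_pair xs)) (snd (rs_pair xs)) x (length xs + 1))"
    by (intro rs_insert_wf) (auto simp: tab_wf_def intro: le_SucI)
  then show ?case by (simp add: rs_pair_snoc)
qed

lemma recording_butlast:
  "snd (rs_pair xs) = erase_label (length xs + 1) (snd (rs_pair (xs @ [x])))"
  unfolding rs_pair_snoc using rs_pair_wf[of xs]
  by (intro rs_insert_erase[symmetric]) (fastforce simp: tab_wf_def)+

text \<open>Equal recording tableaux force equal recording tableaux of all prefixes, so the insertion
  of a word with a prescribed recording tableau can be followed letter by letter.\<close>

lemma recording_prefix:
  assumes "snd (rs_pair (xs @ us)) = snd (rs_pair (ys @ vs))"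
    and "length xs = length ys" and "length us = length vs"
  shows "snd (rs_pair xs) = snd (rs_pair ys)"
  using assms(3,1)
proof (induction us vs rule: rev_induct2)
  case (4 u us v vs)
  then have "snd (rs_pair (xs @ us)) = snd (rs_pair (ys @ vs))"
    using recording_butlast[of "xs @ us" u] recording_butlast[of "ys @ vs" v] assms(2) by simp
  then show ?case using 4 by simp
qed auto

text \<open>A tableau with at most two rows; an empty second row is not listed.\<close>

definition two_rows :: "nat list \<Rightarrow> nat list \<Rightarrow> nat list list" where
  "two_rows R R' = R # (if R' = [] then [] else [R'])"

lemma rs_insert_append:
  assumes "\<forall>y\<in>set R. y < x"
  shows "rs_insert (two_rows R R') (two_rows S S') x k
    = (two_rows (R @ [x]) R', two_rows (S @ [k]) S')"
proof -
  have "dropWhile (\<lambda>y. y < x) R = []" using assms by simp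
  then show ?thesis by (simp add: two_rows_def del: dropWhile_eq_Nil_conv)
qed

lemma rs_insert_bump:
  assumes "\<forall>z\<in>set L. z < x" and "x < y" and "\<forall>z\<in>set R'. z < y" and "R' = [] \<longleftrightarrow> S' = []"
  shows "rs_insert (two_rows (L @ y # M) R') (two_rows S S') x k
    = (two_rows (L @ x # M) (R' @ [y]), two_rows S (S' @ [k]))"
proof -
  have d: "dropWhile (\<lambda>y. y < x) (L @ y # M) = y # M" "takeWhile (\<lambda>y. y < x) (L @ y # M) = L"
    using assms(1,2) by (auto simp: dropWhile_append takeWhile_append)
  have d': "dropWhile (\<lambda>z. z < y) R' = []" using assms(3) by simp
  show ?thesis
    using d d' assms(4) by (simp add: two_rows_def del: dropWhile_eq_Nil_conv)
qed

lemma rs_insert_append_D: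
  assumes "snd (rs_insert (two_rows R R') (two_rows S S') x k) = two_rows (S @ [k]) S'"
  shows "\<forall>y\<in>set R. y < x"
proof (cases "dropWhile (\<lambda>y. y < x) R")
  case Nil
  then show ?thesis by (simp add: dropWhile_eq_Nil_conv)
next
  case (Cons y ys)
  then have "hd (snd (rs_insert (two_rows R R') (two_rows S S') x k)) = S"
    by (simp add: two_rows_def split: prod.split)
  then show ?thesis using assms by (simp add: two_rows_def)
qed

lemma rs_insert_bump_D:
  assumes "snd (rs_insert (two_rows R R') (two_rows S S') x k) = two_rows S (S' @ [k])"
    and "R' = [] \<longleftrightarrow> S' = []"
  obtains L y M where "R = L @ y # M" "\<forall>z\<in>set L. z < x" "x \<le> y" "\<forall>z\<in>set R'. z < y"
proof (cases "dropWhile (\<lambda>y. y < x) R")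
  case Nil
  then have "hd (snd (rs_insert (two_rows R R') (two_rows S S') x k)) = S @ [k]"
    by (simp add: two_rows_def del: dropWhile_eq_Nil_conv)
  then show ?thesis using assms by (simp add: two_rows_def)
next
  case (Cons y M)
  define L where "L = takeWhile (\<lambda>y. y < x) R"
  have R: "R = L @ y # M" using takeWhile_dropWhile_id[of "\<lambda>y. y < x" R] Cons L_def by simp
  have L: "\<forall>z\<in>set L. z < x" unfolding L_def by (auto dest: set_takeWhileD)
  have y: "x \<le> y" using hd_dropWhile[of "\<lambda>y. y < x" R] Cons by auto
  have "\<forall>z\<in>set R'. z < y"
  proof (cases "dropWhile (\<lambda>z. z < y) R'")
    case Nil
    then show ?thesis by (simp add: dropWhile_eq_Nil_conv)
  next
    case Cons': (Cons u us)
    then have ne: "R' \<noteq> []" by auto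
    have "snd (rs_insert (two_rows R R') (two_rows S S') x k) ! 1 = S'"
      using ne assms(2) Cons Cons' by (simp add: two_rows_def split: prod.split)
    then show ?thesis using assms(1) by (simp add: two_rows_def)
  qed
  then show ?thesis using that R L y by blast
qed

section \<open>Words with the recording tableau of the longest element\<close>

text \<open>With \<open>b k = e (2k + 1)\<close> and \<open>a k = e (2k)\<close> this is the word
  \<open>b 0, b 1, a 1, \<dots>, b k, a k\<close>: the row-form of \<open>e\<close> with its blocks reversed, up to block \<open>k\<close>.
  Followed by \<open>a (k + 1)\<close>, for \<open>k = r - 2\<close>, it is the whole row-form.\<close>

fun group_word :: "(nat \<Rightarrow> nat) \<Rightarrow> nat \<Rightarrow> nat list" where
  "group_word e 0 = [e 1]"
| "group_word e (Suc k) = group_word e k @ [e (2 * k + 3), e (2 * k + 2)]"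

lemma length_group_word [simp]: "length (group_word e k) = 2 * k + 1"
  by (induction k) auto

text \<open>The rows of the prescribed recording tableau once block \<open>k\<close> has been inserted: each
  \<open>b k\<close> is appended to the first row, and each \<open>a k\<close> bumps an entry to the end of the second
  row.\<close>

definition lab1 :: "nat \<Rightarrow> nat list" where "lab1 k = 1 # map (\<lambda>i. 2 * i) [1..<k + 1]"

definition lab2 :: "nat \<Rightarrow> nat list" where "lab2 k = map (\<lambda>i. 2 * i + 1) [1..<k + 1]"

text \<open>The rows of the insertion tableau after block \<open>k\<close>, when \<open>j\<close> is the first index with
  \<open>b j < a (j + 1)\<close> (or \<open>j = k\<close>): they are \<open>a 1, \<dots>, a j, b j, a (j + 1), \<dots>, a k\<close> and
  \<open>b 0, \<dots>, b (j - 1), b (j + 1), \<dots>, b k\<close>.\<close>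

definition row1 :: "(nat \<Rightarrow> nat) \<Rightarrow> nat \<Rightarrow> nat \<Rightarrow> nat list" where
  "row1 e j k = map (\<lambda>i. e (2 * i)) [1..<j + 1] @ e (2 * j + 1) # map (\<lambda>i. e (2 * i)) [j + 1..<k + 1]"

definition row2 :: "(nat \<Rightarrow> nat) \<Rightarrow> nat \<Rightarrow> nat \<Rightarrow> nat list" where
  "row2 e j k = map (\<lambda>i. e (2 * i + 1)) [0..<j] @ map (\<lambda>i. e (2 * i + 1)) [j + 1..<k + 1]"

text \<open>The order relations \<open>a i < b i\<close>, \<open>a 1 < \<dots> < a k\<close> and \<open>b 0 < \<dots> < b k\<close>.\<close>

definition chains :: "(nat \<Rightarrow> nat) \<Rightarrow> nat \<Rightarrow> bool" where
  "chains e k \<longleftrightarrow> (\<forall>i. 1 \<le> i \<and> i \<le> k \<longrightarrow> e (2 * i) < e (2 * i + 1))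
    \<and> strict_mono_on {1..k} (\<lambda>i. e (2 * i)) \<and> strict_mono_on {0..k} (\<lambda>i. e (2 * i + 1))"

text \<open>The index \<open>j\<close> is the first one below \<open>k\<close> with \<open>b j < a (j + 1)\<close>; the value \<open>j = k\<close> means
  that there is none.\<close>

definition first_gap :: "(nat \<Rightarrow> nat) \<Rightarrow> nat \<Rightarrow> nat \<Rightarrow> bool" where
  "first_gap e j k \<longleftrightarrow> j \<le> k \<and> (\<forall>i<j. e (2 * i + 2) < e (2 * i + 1))
    \<and> (j < k \<longrightarrow> e (2 * j + 1) < e (2 * j + 2))"

lemma chainsD:
  assumes "chains e k"
  shows "1 \<le> i \<Longrightarrow> i \<le> k \<Longrightarrow> e (2 * i) < e (2 * i + 1)"
    and "1 \<le> i \<Longrightarrow> i < j \<Longrightarrow> j \<le> k \<Longrightarrow> e (2 * i) < e (2 * j)"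
    and "i < j \<Longrightarrow> j \<le> k \<Longrightarrow> e (2 * i + 1) < e (2 * j + 1)"
  using assms unfolding chains_def strict_mono_on_def by auto

lemma chains_mono: "chains e k \<Longrightarrow> l \<le> k \<Longrightarrow> chains e l"
  unfolding chains_def by (auto simp: strict_mono_on_def)

lemma row2_Nil_iff: "j \<le> k \<Longrightarrow> row2 e j k = [] \<longleftrightarrow> lab2 k = []"
  by (auto simp: row2_def lab2_def)

lemma lab_Suc: "lab1 (Suc k) = lab1 k @ [2 * k + 2]" "lab2 (Suc k) = lab2 k @ [2 * k + 3]"
  by (auto simp: lab1_def lab2_def)

lemma row1_less:
  assumes c: "chains e (Suc k)" and j: "j \<le> k" and y: "y \<in> set (row1 e j k)"
  shows "y < e (2 * k + 3)"
proof -
  have b: "e (2 * i + 1) < e (2 * k + 3)" if "i \<le> k" for i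
    using chainsD(3)[OF c, of i "Suc k"] that by (simp add: numeral_3_eq_3)
  have a: "e (2 * i) < e (2 * k + 3)" if "1 \<le> i" "i \<le> k" for i
    using chainsD(1)[OF c, of i] b[of i] that by simp
  show ?thesis using y a b j unfolding row1_def by auto
qed

lemma rs_pair_group_word_append:
  assumes "rs_pair (group_word e k) = (two_rows (row1 e j k) (row2 e j k), two_rows (lab1 k) (lab2 k))"
    and "chains e (Suc k)" and "j \<le> k"
  shows "rs_pair (group_word e k @ [e (2 * k + 3)])
    = (two_rows (row1 e j k @ [e (2 * k + 3)]) (row2 e j k), two_rows (lab1 (Suc k)) (lab2 k))"
proof -
  have "\<forall>y\<in>set (row1 e j k). y < e (2 * k + 3)"
    using row1_less[OF assms(2,3)] by blast
  then show ?thesis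
    unfolding rs_pair_snoc assms(1) by (simp add: rs_insert_append lab_Suc)
qed

text \<open>Before the first gap, \<open>a (k + 1)\<close> bumps \<open>b k\<close>; from the gap on, it exceeds everything in
  the first row except \<open>b (k + 1)\<close> and bumps that.\<close>

lemma rs_pair_group_word:
  assumes "chains e k" and "first_gap e j k"
  shows "rs_pair (group_word e k) = (two_rows (row1 e j k) (row2 e j k), two_rows (lab1 k) (lab2 k))"
    (is "?goal j k")
  using assms
proof (induction k arbitrary: j)
  case 0
  then show ?case
    by (simp add: first_gap_def rs_pair_def row1_def row2_def lab1_def lab2_def two_rows_def)
next
  case (Suc k)
  have jk: "j \<le> Suc k" using Suc.prems by (simp add: first_gap_def)
  define i where "i = min j k"
  have i: "i \<le> k" by (simp add: i_def)
  have fg: "first_gap e i k" using Suc.prems by (auto simp: first_gap_def i_def)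
  have IH: "rs_pair (group_word e k) = (two_rows (row1 e i k) (row2 e i k), two_rows (lab1 k) (lab2 k))"
    using Suc.IH[OF chains_mono[OF Suc.prems(1)] fg] by simp
  note c = chainsD[OF Suc.prems(1)]
  note s1 = rs_pair_group_word_append[OF IH Suc.prems(1) i]
  have s2: "rs_pair (group_word e (Suc k)) = rs_insert (two_rows (row1 e i k @ [e (2 * k + 3)]) (row2 e i k))
      (two_rows (lab1 (Suc k)) (lab2 k)) (e (2 * k + 2)) (2 * k + 3)"
    using rs_pair_snoc[of "group_word e k @ [e (2 * k + 3)]" "e (2 * k + 2)"] s1
    by (simp add: numeral_3_eq_3)
  have e: "row2 e i k = [] \<longleftrightarrow> lab2 k = []" using row2_Nil_iff[OF i] .
  show ?case
  proof (cases "j = Suc k")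
    case True
    have "e (2 * k + 2) < e (2 * k + 1)" using Suc.prems(2) True by (auto simp: first_gap_def)
    moreover have "\<forall>z\<in>set (map (\<lambda>i. e (2 * i)) [1..<k + 1]). z < e (2 * k + 2)"
      using c(2)[of _ "Suc k"] by auto
    moreover have "\<forall>z\<in>set (row2 e k k). z < e (2 * k + 1)"
      using c(3)[of _ k] by (auto simp: row2_def)
    ultimately have "rs_insert (two_rows (map (\<lambda>i. e (2 * i)) [1..<k + 1] @ e (2 * k + 1) # [e (2 * k + 3)]) (row2 e k k))
        (two_rows (lab1 (Suc k)) (lab2 k)) (e (2 * k + 2)) (2 * k + 3)
      = (two_rows (map (\<lambda>i. e (2 * i)) [1..<k + 1] @ e (2 * k + 2) # [e (2 * k + 3)]) (row2 e k k @ [e (2 * k + 1)]),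
         two_rows (lab1 (Suc k)) (lab2 k @ [2 * k + 3]))"
      using e True by (intro rs_insert_bump) (auto simp: i_def)
    then show ?thesis
      unfolding s2 using True by (simp add: i_def row1_def row2_def lab_Suc numeral_3_eq_3)
  next
    case False
    then have j: "j \<le> k" "i = j" using jk by (auto simp: i_def)
    have gap: "e (2 * j + 1) < e (2 * j + 2)" using Suc.prems(2) j by (auto simp: first_gap_def)
    have "e (2 * j + 2) \<le> e (2 * k + 2)"
      using c(2)[of "Suc j" "Suc k"] j by (cases "j = k") auto
    then have "\<forall>z\<in>set (row1 e j k). z < e (2 * k + 2)"
      using c(2)[of _ "Suc k"] j gap by (auto simp: row1_def)
    moreover have "e (2 * k + 2) < e (2 * k + 3)"
      using c(1)[of "Suc k"] by (simp add: numeral_3_eq_3)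
    moreover have "\<forall>z\<in>set (row2 e j k). z < e (2 * k + 3)"
      using c(3)[of _ "Suc k"] j by (auto simp: row2_def numeral_3_eq_3)
    ultimately have "rs_insert (two_rows (row1 e j k @ e (2 * k + 3) # []) (row2 e j k))
        (two_rows (lab1 (Suc k)) (lab2 k)) (e (2 * k + 2)) (2 * k + 3)
      = (two_rows (row1 e j k @ e (2 * k + 2) # []) (row2 e j k @ [e (2 * k + 3)]),
         two_rows (lab1 (Suc k)) (lab2 k @ [2 * k + 3]))"
      using e j by (intro rs_insert_bump) auto
    then show ?thesis
      unfolding s2 using j by (simp add: row1_def row2_def lab_Suc numeral_3_eq_3)
  qed
qed

lemma exists_first_gap:
  assumes "inj e"
  obtains j where "first_gap e j k"
proof (cases "\<exists>i<k. e (2 * i + 1) < e (2 * i + 2)")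
  case True
  define j where "j = (LEAST i. i < k \<and> e (2 * i + 1) < e (2 * i + 2))"
  have j: "j < k" "e (2 * j + 1) < e (2 * j + 2)"
    using LeastI_ex[OF True] by (auto simp: j_def)
  have "e (2 * i + 2) < e (2 * i + 1)" if "i < j" for i
  proof -
    have "\<not> e (2 * i + 1) < e (2 * i + 2)"
      using not_less_Least[of i "\<lambda>i. i < k \<and> e (2 * i + 1) < e (2 * i + 2)"] that j by (auto simp: j_def)
    moreover have "e (2 * i + 1) \<noteq> e (2 * i + 2)" using assms by (auto simp: inj_eq)
    ultimately show ?thesis by simp
  qed
  then show ?thesis using that[of j] j by (auto simp: first_gap_def)
next
  case False
  have "e (2 * i + 2) < e (2 * i + 1)" if "i < k" for i
  proof -
    have "e (2 * i + 1) \<noteq> e (2 * i + 2)" using assms by (auto simp: inj_eq)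
    then show ?thesis using False that by (meson linorder_neqE_nat)
  qed
  then show ?thesis using that[of k] by (auto simp: first_gap_def)
qed

lemma sorted_row1:
  assumes c: "chains e k" and fg: "first_gap e j k"
  shows "sorted (row1 e j k)"
proof -
  have j: "j \<le> k" using fg by (simp add: first_gap_def)
  have 1: "e (2 * x) \<le> e (2 * j + 1)" if "1 \<le> x" "x \<le> j" for x
    using chainsD(1)[OF c, of x] chainsD(3)[OF c, of x j] j that by (cases "x = j") auto
  have 2: "e (2 * j + 1) \<le> e (2 * y)" if "j < y" "y \<le> k" for y
  proof -
    have "e (2 * j + 1) < e (2 * Suc j)" using fg that by (auto simp: first_gap_def)
    also have "\<dots> \<le> e (2 * y)" using chainsD(2)[OF c, of "Suc j" y] that by (cases "Suc j = y") auto
    finally show ?thesis by simp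
  qed
  have s: "sorted (map (\<lambda>i. e (2 * i)) [x..<y + 1])" if "1 \<le> x" "y \<le> k" for x y
    unfolding sorted_map
    by (rule sorted_wrt_mono_rel[OF _ sorted_wrt_upt])
      (use chainsD(2)[OF c] that in \<open>auto intro: less_imp_le\<close>)
  have 3: "e (2 * x) \<le> e (2 * y)" if "1 \<le> x" "x \<le> j" "j < y" "y \<le> k" for x y
    using 1[OF that(1,2)] 2[OF that(3,4)] by simp
  show ?thesis unfolding row1_def using 1 2 3 s[of 1 j] s[of "Suc j" k] j
    by (auto simp: sorted_append)
qed

text \<open>Conversely the prescribed recording tableau forces the chains. The bumped entry \<open>y\<close> must
  exceed the second row, which is how the next \<open>a\<close> and \<open>b\<close> are seen to exceed the previous
  ones.\<close>

lemma chains_of_recording: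
  assumes inj: "inj e" and gr: "\<And>i. 1 \<le> i \<Longrightarrow> i \<le> m \<Longrightarrow> e (2 * i) < e (2 * i + 1)"
    and Q: "\<And>k. k < m \<Longrightarrow> snd (rs_pair (group_word e k @ [e (2 * k + 3)])) = two_rows (lab1 (Suc k)) (lab2 k)"
    and Q': "\<And>k. k \<le> m \<Longrightarrow> snd (rs_pair (group_word e k)) = two_rows (lab1 k) (lab2 k)"
  shows "k \<le> m \<Longrightarrow> chains e k"
proof (induction k)
  case 0
  then show ?case by (auto simp: chains_def strict_mono_on_def)
next
  case (Suc k)
  then have c: "chains e k" by simp
  obtain j where fg: "first_gap e j k" using exists_first_gap[OF inj] .
  have j: "j \<le> k" using fg by (simp add: first_gap_def)
  note st = rs_pair_group_word[OF c fg]
  have "snd (rs_insert (two_rows (row1 e j k) (row2 e j k)) (two_rows (lab1 k) (lab2 k)) (e (2 * k + 3)) (2 * k + 2))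
      = two_rows (lab1 k @ [2 * k + 2]) (lab2 k)"
    using Q[of k] Suc.prems by (simp add: rs_pair_snoc st lab_Suc)
  from rs_insert_append_D[OF this] have up: "\<forall>y\<in>set (row1 e j k). y < e (2 * k + 3)" .
  then have s1: "rs_pair (group_word e k @ [e (2 * k + 3)])
      = (two_rows (row1 e j k @ [e (2 * k + 3)]) (row2 e j k), two_rows (lab1 (Suc k)) (lab2 k))"
    unfolding rs_pair_snoc st by (simp add: rs_insert_append lab_Suc)
  have "snd (rs_insert (two_rows (row1 e j k @ [e (2 * k + 3)]) (row2 e j k))
      (two_rows (lab1 (Suc k)) (lab2 k)) (e (2 * k + 2)) (2 * k + 3)) = two_rows (lab1 (Suc k)) (lab2 k @ [2 * k + 3])"
    using rs_pair_snoc[of "group_word e k @ [e (2 * k + 3)]" "e (2 * k + 2)"] s1 Q'[OF Suc.prems]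
    by (simp add: numeral_3_eq_3 lab_Suc)
  then obtain L y M where y: "row1 e j k @ [e (2 * k + 3)] = L @ y # M" "\<forall>z\<in>set L. z < e (2 * k + 2)"
      "e (2 * k + 2) \<le> y" "\<forall>z\<in>set (row2 e j k). z < y"
    using row2_Nil_iff[OF j] by (rule rs_insert_bump_D)
  have sorted: "sorted (row1 e j k @ [e (2 * k + 3)])"
    using sorted_row1[OF c fg] up by (auto simp: sorted_append less_imp_le)
  have b: "e (2 * k + 1) < e (2 * k + 3)"
  proof (cases "j = k")
    case True
    then show ?thesis using up by (simp add: row1_def)
  next
    case False
    then have "e (2 * k + 1) \<in> set (row2 e j k)" using j by (auto simp: row2_def)
    then have "e (2 * k + 1) < y" using y by blast
    moreover have "y \<in> set (row1 e j k @ [e (2 * k + 3)])" unfolding y(1) by simp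
    ultimately show ?thesis using up by auto
  qed
  have a: "e (2 * k) < e (2 * k + 2)" if "1 \<le> k"
  proof (rule ccontr)
    assume "\<not> ?thesis"
    \<comment> \<open>Then \<open>a (k + 1)\<close> bumps an entry \<open>y \<le> a k\<close>, which is too small for the second row.\<close>
    moreover have mem: "e (2 * k) \<in> set (L @ y # M)"
      unfolding y(1)[symmetric] using j that by (cases "j = k") (auto simp: row1_def)
    moreover have "sorted (L @ y # M)" using sorted y(1) by simp
    ultimately have "y \<le> e (2 * k)"
      using y(2) by (auto simp: sorted_append)
    moreover have "\<exists>z\<in>set (row2 e j k). e (2 * k) < z"
    proof (cases "j = k")
      case True
      then have "e (2 * (k - 1) + 2) < e (2 * (k - 1) + 1)" using fg that by (auto simp: first_gap_def)
      then have "e (2 * k) < e (2 * (k - 1) + 1)" using that by (cases k) auto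
      moreover have "e (2 * (k - 1) + 1) \<in> set (row2 e j k)" using True that by (auto simp: row2_def)
      ultimately show ?thesis by blast
    next
      case False
      then have "e (2 * k + 1) \<in> set (row2 e j k)" using j by (auto simp: row2_def)
      then show ?thesis using chainsD(1)[OF c that] by blast
    qed
    ultimately show False using y(4) by auto
  qed
  show ?case
    unfolding chains_def
  proof (intro conjI strict_mono_onI allI impI)
    show "e (2 * i) < e (2 * i + 1)" if "1 \<le> i \<and> i \<le> Suc k" for i
      using gr that Suc.prems by auto
    show "e (2 * i) < e (2 * l)" if "i \<in> {1..Suc k}" "l \<in> {1..Suc k}" "i < l" for i l
    proof (cases "l = Suc k")
      case True
      have "e (2 * i) \<le> e (2 * k)" using chainsD(2)[OF c, of i k] that True by (cases "i = k") auto
      then show ?thesis using a that True by auto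
    qed (use chainsD(2)[OF c, of i l] that in auto)
    show "e (2 * i + 1) < e (2 * l + 1)" if "i \<in> {0..Suc k}" "l \<in> {0..Suc k}" "i < l" for i l
    proof (cases "l = Suc k")
      case True
      have "e (2 * i + 1) \<le> e (2 * k + 1)" using chainsD(3)[OF c, of i k] that True by (cases "i = k") auto
      then show ?thesis using b that True by (auto simp: numeral_3_eq_3)
    qed (use chainsD(3)[OF c, of i l] that in auto)
  qed
qed

text \<open>The last letter \<open>a (m + 1)\<close> is appended to the first row exactly when it exceeds \<open>a m\<close> and
  there is a gap somewhere in \<open>0, \<dots>, m\<close>: without a gap before \<open>m\<close> the first row ends in \<open>b m\<close>.\<close>

lemma recording_gap:
  assumes "chains e m" and "first_gap e j (Suc m)" and "j \<le> m" and "1 \<le> m \<Longrightarrow> e (2 * m) < e (2 * m + 2)"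
  shows "snd (rs_pair (group_word e m @ [e (2 * m + 2)])) = two_rows (lab1 (Suc m)) (lab2 m)"
proof -
  have fg: "first_gap e j m" using assms(2,3) by (auto simp: first_gap_def)
  have gap: "e (2 * j + 1) < e (2 * j + 2)" using assms(2,3) by (auto simp: first_gap_def)
  have m: "e (2 * i) < e (2 * m + 2)" if "1 \<le> i" "i \<le> m" for i
    using chainsD(2)[OF assms(1), of i m] that assms(4) by (cases "i = m") auto
  have "\<forall>y\<in>set (row1 e j m). y < e (2 * m + 2)"
    using m m[of "Suc j"] gap assms(3) by (cases "j = m") (auto simp: row1_def)
  then show ?thesis
    unfolding rs_pair_snoc rs_pair_group_word[OF assms(1) fg]
    by (simp add: rs_insert_append lab_Suc)
qed

lemma gap_of_recording:
  assumes "inj e" and c: "chains e m"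
    and Q: "snd (rs_pair (group_word e m @ [e (2 * m + 2)])) = two_rows (lab1 (Suc m)) (lab2 m)"
  shows "(1 \<le> m \<longrightarrow> e (2 * m) < e (2 * m + 2)) \<and> (\<exists>j\<le>m. e (2 * j + 1) < e (2 * j + 2))"
proof -
  obtain j where fg: "first_gap e j m" using exists_first_gap[OF assms(1)] .
  have j: "j \<le> m" using fg by (simp add: first_gap_def)
  have "snd (rs_insert (two_rows (row1 e j m) (row2 e j m)) (two_rows (lab1 m) (lab2 m)) (e (2 * m + 2)) (2 * m + 2))
      = two_rows (lab1 m @ [2 * m + 2]) (lab2 m)"
    using Q by (simp add: rs_pair_snoc rs_pair_group_word[OF c fg] lab_Suc)
  from rs_insert_append_D[OF this] have up: "\<forall>y\<in>set (row1 e j m). y < e (2 * m + 2)" .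
  have "e (2 * m) < e (2 * m + 2)" if "1 \<le> m"
    using up j that by (cases "j = m") (auto simp: row1_def)
  moreover have "e (2 * j + 1) < e (2 * j + 2)"
  proof (cases "j = m")
    case True
    then show ?thesis using up by (simp add: row1_def)
  qed (use fg in \<open>auto simp: first_gap_def\<close>)
  ultimately show ?thesis using j by blast
qed

lemma row_form_block_swap:
  assumes r: "3 \<le> r"
  shows "row_form (2 * r - 2) (block_swap (r - 2) \<otimes>\<^bsub>symR (2 * r - 2)\<^esub> e)
    = group_word e (r - 2) @ [e (2 * (r - 2) + 2)]"
proof -
  let ?w = "block_swap (r - 2)"
  have n: "2 * r - 2 + 1 = Suc (2 * (r - 2) + 2)" using r by simp
  have pre: "map (e \<circ> ?w) [1..<2 * k + 2] = group_word e k" if "k \<le> r - 2" for k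
    using that
  proof (induction k)
    case 0
    then show ?case by (simp add: block_swap_def)
  next
    case (Suc k)
    have "[1..<2 * Suc k + 2] = [1..<2 * k + 2] @ [2 * k + 2, 2 * k + 3]"
      by (simp add: numeral_3_eq_3)
    moreover have "?w (2 * k + 2) = 2 * k + 3" "?w (2 * k + 3) = 2 * k + 2"
      using Suc.prems by (auto simp: block_swap_def)
    ultimately show ?case using Suc by (simp add: numeral_3_eq_3)
  qed
  have "?w (2 * (r - 2) + 2) = 2 * (r - 2) + 2" by (simp add: block_swap_def)
  then show ?thesis
    unfolding row_form_def symR_simps n using pre[of "r - 2"] by (simp add: comp_def)
qed

lemma group_word_split:
  assumes "k \<le> m"
  obtains us where "group_word f m = group_word f k @ us" "length us = 2 * (m - k)"
    "k < m \<Longrightarrow> us = f (2 * k + 3) # tl us"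
proof -
  have "\<exists>us. group_word f m = group_word f k @ us \<and> length us = 2 * (m - k)
      \<and> (k < m \<longrightarrow> us = f (2 * k + 3) # tl us)"
    using assms
  proof (induction rule: inc_induct)
    case base
    then show ?case by simp
  next
    case (step k)
    then obtain us where "group_word f m = group_word f (Suc k) @ us" "length us = 2 * (m - Suc k)"
      by blast
    then show ?case using step(2) by simp
  qed
  then show ?thesis using that by blast
qed

text \<open>The identity represents the longest element itself, which thus gives the prescribed
  recording tableau.\<close>

lemma chains_id: "chains id k"
  by (simp add: chains_def strict_mono_on_def)

lemma first_gap_id: "first_gap id 0 k"
  by (simp add: first_gap_def)

text \<open>Membership in the right cell set: the \<open>a\<close> and the \<open>b\<close> entries form chains and
  some \<open>b v\<close> is smaller than \<open>a (v + 1)\<close>.\<close>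

lemma Z_of_lam_of:
  assumes r: "3 \<le> r"
  shows "e \<in> Z_of (lam_of r) \<longleftrightarrow> e permutes {1..2 * r - 2} \<and> chains e (r - 2)
    \<and> e (2 * (r - 2)) < e (2 * (r - 2) + 2) \<and> (\<exists>v\<le>r - 2. first_gap e v (Suc (r - 2)))"
    (is "_ \<longleftrightarrow> ?R")
proof -
  let ?n = "2 * r - 2" and ?m = "r - 2"
  let ?Q = "two_rows (lab1 (Suc ?m)) (lab2 ?m)"
  have m: "1 \<le> ?m" using r by simp
  have id: "snd (rs_pair (group_word id ?m @ [id (2 * ?m + 2)])) = ?Q"
    by (rule recording_gap[OF chains_id first_gap_id]) auto
  have "row_form ?n (block_swap ?m) = group_word id ?m @ [id (2 * ?m + 2)]"
    using row_form_block_swap[OF r, of id] by (simp add: symR_simps)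
  then have "recording_tableau ?n (block_swap ?m) = ?Q"
    unfolding recording_tableau_def using id by simp
  then have Z: "e \<in> Z_of (lam_of r) \<longleftrightarrow> e permutes {1..?n} \<and>
      (\<forall>k. 1 \<le> k \<and> k \<le> ?m \<longrightarrow> e (2 * k) < e (2 * k + 1)) \<and>
      snd (rs_pair (group_word e ?m @ [e (2 * ?m + 2)])) = ?Q"
    by (simp add: Z_of_def X_of_lam_of[OF r] sum_list_lam_of[OF r] longest_of_lam_of[OF r]
        right_cell_equiv_def recording_tableau_def row_form_block_swap[OF r])
  show ?thesis
  proof
    assume "e \<in> Z_of (lam_of r)"
    then have p: "e permutes {1..?n}" and gr: "\<And>k. 1 \<le> k \<Longrightarrow> k \<le> ?m \<Longrightarrow> e (2 * k) < e (2 * k + 1)"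
      and Q: "snd (rs_pair (group_word e ?m @ [e (2 * ?m + 2)])) = ?Q"
      unfolding Z by auto
    have inj: "inj e" by (rule permutes_inj[OF p])
    have full: "snd (rs_pair (group_word e ?m @ [e (2 * ?m + 2)])) = snd (rs_pair (group_word id ?m @ [id (2 * ?m + 2)]))"
      using Q id by simp
    have Q1: "snd (rs_pair (group_word e k)) = snd (rs_pair (group_word id k))" if k: "k \<le> ?m" for k
    proof -
      obtain us where us: "group_word e ?m = group_word e k @ us" "length us = 2 * (?m - k)"
        using group_word_split[OF k] .
      obtain vs where vs: "group_word id ?m = group_word id k @ vs" "length vs = 2 * (?m - k)"
        using group_word_split[OF k] .
      show ?thesis
        using recording_prefix[of "group_word e k" "us @ [e (2 * ?m + 2)]" "group_word id k" "vs @ [id (2 * ?m + 2)]"]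
          full us vs by simp
    qed
    have Q2: "snd (rs_pair (group_word e k @ [e (2 * k + 3)])) = snd (rs_pair (group_word id k @ [id (2 * k + 3)]))"
      if k: "k < ?m" for k
    proof -
      obtain us where us: "group_word e ?m = group_word e k @ us" "length us = 2 * (?m - k)"
        "us = e (2 * k + 3) # tl us"
        using group_word_split[OF less_imp_le[OF k]] k by blast
      obtain vs where vs: "group_word id ?m = group_word id k @ vs" "length vs = 2 * (?m - k)"
        "vs = id (2 * k + 3) # tl vs"
        using group_word_split[OF less_imp_le[OF k]] k by blast
      have e: "group_word e ?m = (group_word e k @ [e (2 * k + 3)]) @ tl us"
        and i: "group_word id ?m = (group_word id k @ [id (2 * k + 3)]) @ tl vs"
        using us(1,3) vs(1,3) by simp_all
      show ?thesis
        using recording_prefix[of "group_word e k @ [e (2 * k + 3)]" "tl us @ [e (2 * ?m + 2)]"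
            "group_word id k @ [id (2 * k + 3)]" "tl vs @ [id (2 * ?m + 2)]"] full us(2) vs(2)
        unfolding e i by simp
    qed
    note idk = rs_pair_group_word[OF chains_id first_gap_id]
    have c: "chains e ?m"
    proof (rule chains_of_recording[OF inj gr])
      show "snd (rs_pair (group_word e k @ [e (2 * k + 3)])) = two_rows (lab1 (Suc k)) (lab2 k)" if "k < ?m" for k
        unfolding Q2[OF that] using rs_pair_group_word_append[OF idk chains_id, of k] by simp
      show "snd (rs_pair (group_word e k)) = two_rows (lab1 k) (lab2 k)" if "k \<le> ?m" for k
        unfolding Q1[OF that] idk by simp
    qed auto
    note g = gap_of_recording[OF inj c Q]
    obtain v where fg: "first_gap e v (Suc ?m)" using exists_first_gap[OF inj] .
    obtain j where j: "j \<le> ?m" "e (2 * j + 1) < e (2 * j + 2)" using g by blast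
    have "v \<le> ?m"
    proof (rule ccontr)
      assume "\<not> v \<le> ?m"
      then have "j < v" using j by simp
      then have "e (2 * j + 2) < e (2 * j + 1)" using fg unfolding first_gap_def by blast
      then show False using j by simp
    qed
    then show ?R using p c g m fg by blast
  next
    assume R: ?R
    then obtain v where v: "v \<le> ?m" "first_gap e v (Suc ?m)" by blast
    have c: "chains e ?m" using R by blast
    have "snd (rs_pair (group_word e ?m @ [e (2 * ?m + 2)])) = ?Q"
      using R by (intro recording_gap[OF c v(2,1)]) blast
    then show "e \<in> Z_of (lam_of r)"
      unfolding Z using R chainsD(1)[OF c] by blast
  qed
qed

section \<open>Diagrams with row sizes \<open>(1, 2, \<dots>, 2, 1)\<close>\<close>

text \<open>Filling a finite set along a linear order numbers its elements from 1.\<close>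

lemma rank_bij:
  assumes fin: "finite D"
    and total: "\<And>x y. x \<in> D \<Longrightarrow> y \<in> D \<Longrightarrow> ord x y \<or> ord y x"
    and antisym: "\<And>x y. ord x y \<Longrightarrow> ord y x \<Longrightarrow> x = y"
    and trans: "\<And>x y z. ord x y \<Longrightarrow> ord y z \<Longrightarrow> ord x z"
  shows "bij_betw (\<lambda>x. card {y \<in> D. ord y x}) D {1..card D}"
proof -
  let ?f = "\<lambda>x. card {y \<in> D. ord y x}"
  have lt: "?f x < ?f y" if "x \<in> D" "y \<in> D" "ord x y" "x \<noteq> y" for x y
  proof (rule psubset_card_mono)
    show "finite {z \<in> D. ord z y}" using fin by simp
    have "y \<in> {z \<in> D. ord z y}" using total[of y y] that by blast
    moreover have "y \<notin> {z \<in> D. ord z x}" using antisym that by blast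
    moreover have "{z \<in> D. ord z x} \<subseteq> {z \<in> D. ord z y}" using trans that by blast
    ultimately show "{z \<in> D. ord z x} \<subset> {z \<in> D. ord z y}" by blast
  qed
  have inj: "inj_on ?f D"
  proof (rule inj_onI)
    fix x y assume "x \<in> D" "y \<in> D" "?f x = ?f y"
    then show "x = y" using lt[of x y] lt[of y x] total[of x y] by fastforce
  qed
  have "?f x \<in> {1..card D}" if "x \<in> D" for x
  proof -
    have "x \<in> {y \<in> D. ord y x}" using total[of x x] that by blast
    then have "0 < ?f x" using fin by (auto simp: card_gt_0_iff)
    moreover have "?f x \<le> card D" by (rule card_mono) (use fin in auto)
    ultimately show ?thesis by simp
  qed
  then have "?f ` D \<subseteq> {1..card D}" by blast
  moreover have "card (?f ` D) = card {1..card D}" using card_image[OF inj] by simp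
  ultimately have "?f ` D = {1..card D}" by (intro card_subset_eq) auto
  then show ?thesis using inj by (simp add: bij_betw_def)
qed

lemma rank_eq:
  assumes inj: "inj_on g I" and f: "bij_betw f I {1..N}"
    and le: "\<And>i j. i \<in> I \<Longrightarrow> j \<in> I \<Longrightarrow> ord (g i) (g j) \<longleftrightarrow> f i \<le> f j"
    and i: "i \<in> I"
  shows "card {y \<in> g ` I. ord y (g i)} = (f i :: nat)"
proof -
  have fi: "f i \<le> N" using bij_betwE[OF f] i by auto
  have "{y \<in> g ` I. ord y (g i)} = g ` {j \<in> I. f j \<le> f i}" using le i by auto
  moreover have "inj_on g {j \<in> I. f j \<le> f i}" using inj by (rule inj_on_subset) auto
  ultimately have "card {y \<in> g ` I. ord y (g i)} = card {j \<in> I. f j \<le> f i}"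
    by (simp add: card_image)
  also have "\<dots> = card (f ` {j \<in> I. f j \<le> f i})"
    using f by (intro card_image[symmetric]) (auto simp: bij_betw_def inj_on_def)
  also have "f ` {j \<in> I. f j \<le> f i} = {1..f i}"
  proof (intro equalityI subsetI)
    fix t assume t: "t \<in> {1..f i}"
    then have "t \<in> f ` I" using f fi by (auto simp: bij_betw_def)
    then show "t \<in> f ` {j \<in> I. f j \<le> f i}" using t by auto
  qed (use bij_betwE[OF f] in auto)
  finally show ?thesis by simp
qed

lemma row_filling_bij: "finite D \<Longrightarrow> bij_betw (row_filling D) D {1..card D}"
  unfolding row_filling_def
  by (rule rank_bij[where ord = "\<lambda>y x. fst y < fst x \<or> (fst y = fst x \<and> snd y \<le> snd x)"])
    (auto simp: prod_eq_iff)

lemma col_filling_bij: "finite D \<Longrightarrow> bij_betw (col_filling D) D {1..card D}"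
  unfolding col_filling_def
  by (rule rank_bij[where ord = "\<lambda>y x. snd y < snd x \<or> (snd y = snd x \<and> fst y \<le> fst x)"])
    (auto simp: prod_eq_iff)

lemma w_of_eqI:
  assumes "finite D" and w: "w permutes {1..card D}"
    and wD: "\<And>x. x \<in> D \<Longrightarrow> w (row_filling D x) = col_filling D x"
  shows "w_of D = w"
  unfolding w_of_def symR_simps
proof (rule the_equality)
  show "w \<in> {p. p permutes {1..card D}} \<and> (\<forall>x\<in>D. w (row_filling D x) = col_filling D x)"
    using w wD by simp
  fix v assume v: "v \<in> {p. p permutes {1..card D}} \<and> (\<forall>x\<in>D. v (row_filling D x) = col_filling D x)"
  show "v = w"
  proof
    fix i
    show "v i = w i"
    proof (cases "i \<in> {1..card D}")
      case True
      then have "i \<in> row_filling D ` D"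
        using row_filling_bij[OF assms(1)] by (simp add: bij_betw_def)
      then obtain x where "x \<in> D" "i = row_filling D x" by blast
      then show ?thesis using v wD by simp
    next
      case False
      have "v permutes {1..card D}" using v by simp
      then have "v i = i" using False by (rule permutes_not_in)
      then show ?thesis using permutes_not_in[OF w False] by simp
    qed
  qed
qed

lemma w_of_spec:
  assumes "finite D" and x: "x \<in> D"
  shows "w_of D (row_filling D x) = col_filling D x"
proof -
  let ?R = "row_filling D" and ?C = "col_filling D" and ?N = "{1..card D}"
  define w where "w i = (if i \<in> ?N then ?C (inv_into D ?R i) else i)" for i
  note R = row_filling_bij[OF assms(1)] and C = col_filling_bij[OF assms(1)]
  have "bij_betw (?C \<circ> inv_into D ?R) ?N ?N"
    using bij_betw_trans[OF bij_betw_inv_into[OF R] C] .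
  then have "bij_betw w ?N ?N"
    by (rule bij_betw_cong[THEN iffD1, rotated]) (simp only: w_def comp_apply if_True)
  then have p: "w permutes ?N" by (rule bij_imp_permutes) (simp only: w_def if_False)
  have wD: "w (?R y) = ?C y" if "y \<in> D" for y
    using bij_betwE[OF R] that bij_betw_inv_into_left[OF R that] by (auto simp: w_def)
  show ?thesis using w_of_eqI[OF assms(1) p wD] wD[OF x] by simp
qed

lemma diagram_finite: "D \<in> diagrams_of lam \<Longrightarrow> finite D"
  by (simp add: diagrams_of_def diagram_def)

lemma card_rows_le:
  assumes D: "D \<in> diagrams_of lam"
  shows "k \<le> length lam \<Longrightarrow> card {x \<in> D. fst x \<le> k} = sum_list (take k lam)"
proof (induction k)
  case 0
  have "fst x \<noteq> 0" if "x \<in> D" for x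
  proof -
    have "fst x \<in> {1..length lam}" using D that by (auto simp: diagrams_of_def)
    then show ?thesis by simp
  qed
  then have "{x \<in> D. fst x \<le> 0} = {}" by auto
  then show ?case by (simp only: card.empty) simp
next
  case (Suc k)
  have "{x \<in> D. fst x \<le> Suc k} = {x \<in> D. fst x \<le> k} \<union> {x \<in> D. fst x = Suc k}" by auto
  moreover have "card ({x \<in> D. fst x \<le> k} \<union> {x \<in> D. fst x = Suc k})
      = card {x \<in> D. fst x \<le> k} + card {x \<in> D. fst x = Suc k}"
    using diagram_finite[OF D] by (intro card_Un_disjoint) auto
  moreover have "card {x \<in> D. fst x = Suc k} = lam ! k"
    using D Suc.prems by (auto simp: diagrams_of_def)
  ultimately show ?case using Suc by (simp add: take_Suc_conv_app_nth)
qed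

lemma nth_lam_of:
  "3 \<le> r \<Longrightarrow> k < r \<Longrightarrow> lam_of r ! k = (if k = 0 \<or> k = r - 1 then 1 else 2)"
  by (auto simp: lam_of_def nth_append nth_Cons split: nat.split)

text \<open>The node in position \<open>i\<close> of the reading order by rows lies in row \<open>i div 2 + 1\<close>. A diagram
  with these row sizes is therefore determined by the columns of its nodes.\<close>

lemma lam_of_rows:
  assumes r: "3 \<le> r" and D: "D \<in> diagrams_of (lam_of r)"
  shows "card D = 2 * r - 2"
    and "x \<in> D \<Longrightarrow> fst x = row_filling D x div 2 + 1"
proof -
  note fin = diagram_finite[OF D]
  have rows: "fst x \<in> {1..r}" if "x \<in> D" for x
    using D that length_lam_of[OF r] by (auto simp: diagrams_of_def)
  have le: "card {x \<in> D. fst x \<le> k} = (if k = 0 then 0 else if k < r then 2 * k - 1 else 2 * r - 2)"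
    if "k \<le> r" for k
    using card_rows_le[OF D] sum_take_lam_of[OF r that] that length_lam_of[OF r] by simp
  have "{x \<in> D. fst x \<le> r} = D" using rows by auto
  then show "card D = 2 * r - 2" using le[of r] r by simp
  assume x: "x \<in> D"
  define k where "k = fst x - 1"
  have k: "fst x = Suc k" "k < r" using rows[OF x] by (auto simp: k_def)
  let ?A = "{y \<in> D. fst y \<le> k}" and ?B = "{y \<in> D. fst y = Suc k \<and> snd y \<le> snd x}"
  have "{y \<in> D. fst y < fst x \<or> (fst y = fst x \<and> snd y \<le> snd x)} = ?A \<union> ?B"
    unfolding k(1) by auto
  then have rf: "row_filling D x = card (?A \<union> ?B)" unfolding row_filling_def by simp
  have c: "card (?A \<union> ?B) = card ?A + card ?B" using fin by (intro card_Un_disjoint) auto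
  have "card {x} \<le> card ?B" by (rule card_mono) (use fin x k in auto)
  then have "1 \<le> card ?B" by simp
  moreover have "card ?B \<le> card {y \<in> D. fst y = Suc k}" using fin by (intro card_mono) auto
  moreover have "card {y \<in> D. fst y = Suc k} = lam_of r ! k"
    using D k length_lam_of[OF r] by (auto simp: diagrams_of_def)
  ultimately show "fst x = row_filling D x div 2 + 1"
    using rf c le[of k] k nth_lam_of[OF r k(2)] by (auto split: if_splits)
qed

text \<open>The column of the node in position \<open>i\<close> (by rows) of the \<open>v\<close>-th diagram. The summand
  depending on \<open>v = 0\<close> accounts for the first of the three columns being absent in that case;
  this makes the definition uniform in \<open>v\<close>.\<close>

definition pcol :: "nat \<Rightarrow> nat \<Rightarrow> nat" where
  "pcol v i = (if v = 0 then 0 else 1) + i mod 2 + (if i div 2 \<le> v then 0 else 1)"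

text \<open>The node in position \<open>i\<close> of the \<open>v\<close>-th diagram.\<close>

definition pnode :: "nat \<Rightarrow> nat \<Rightarrow> node" where
  "pnode v i = (i div 2 + 1, pcol v i)"

text \<open>The permutation of the \<open>v\<close>-th diagram: the entry of its \<open>i\<close>-th node in the filling by
  columns. Points outside \<open>{1..2r - 2}\<close> are fixed.\<close>

definition pperm :: "nat \<Rightarrow> nat \<Rightarrow> nat \<Rightarrow> nat" where
  "pperm r v i =
     (if i < 1 \<or> 2 * r - 2 < i then i
      else if even i then (if i div 2 \<le> v then i div 2 else v + i div 2 + 1)
      else (if i div 2 \<le> v then v + i div 2 + 1 else r + i div 2))"

lemma pcol_simps: "pcol v (2 * k) = (if v = 0 then 0 else 1) + (if k \<le> v then 0 else 1)"
  "pcol v (2 * k + 1) = (if v = 0 then 0 else 1) + 1 + (if k \<le> v then 0 else 1)"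
  by (simp_all add: pcol_def)

lemma pperm_simps:
  "1 \<le> k \<Longrightarrow> k \<le> r - 1 \<Longrightarrow> pperm r v (2 * k) = (if k \<le> v then k else v + k + 1)"
  "k + 2 \<le> r \<Longrightarrow> pperm r v (2 * k + 1) = (if k \<le> v then v + k + 1 else r + k)"
  by (auto simp: pperm_def)

lemma position_cases:
  fixes i r :: nat
  assumes "i \<in> {1..2 * r - 2}"
  obtains k where "i = 2 * k" "1 \<le> k" "k \<le> r - 1" | k where "i = 2 * k + 1" "k + 2 \<le> r"
proof (cases "even i")
  case True
  then have "i = 2 * (i div 2)" "1 \<le> i div 2" "i div 2 \<le> r - 1" using assms by auto
  then show ?thesis using that(1) by blast
next
  case False
  then have "i = 2 * (i div 2) + 1" by presburger
  moreover from this have "i div 2 + 2 \<le> r" using assms by simp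
  ultimately show ?thesis using that(2) by blast
qed

text \<open>The values of \<open>pperm\<close> are ordered as the nodes are when read by columns.\<close>

lemma pperm_le_iff:
  assumes v: "v \<le> r - 2" and i: "i \<in> {1..2 * r - 2}" and j: "j \<in> {1..2 * r - 2}"
  shows "(pcol v i < pcol v j \<or> (pcol v i = pcol v j \<and> i div 2 \<le> j div 2)) \<longleftrightarrow> pperm r v i \<le> pperm r v j"
  using i
proof (cases rule: position_cases)
  case i': (1 k)
  from j show ?thesis
    by (cases rule: position_cases) (use i' v in \<open>auto simp: pcol_simps pperm_simps simp del: One_nat_def mult_Suc_right\<close>)
next
  case i': (2 k)
  from j show ?thesis
    by (cases rule: position_cases) (use i' v in \<open>auto simp: pcol_simps pperm_simps simp del: One_nat_def mult_Suc_right\<close>)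
qed

lemma pnode_inj: "inj (pnode v)"
proof (rule injI)
  fix i j assume "pnode v i = pnode v j"
  then have "i div 2 = j div 2" "i mod 2 = j mod 2" by (auto simp: pnode_def pcol_def)
  then show "i = j" by (metis div_mult_mod_eq)
qed

lemma pperm_range:
  assumes "v \<le> r - 2" and "i \<in> {1..2 * r - 2}"
  shows "pperm r v i \<in> {1..2 * r - 2}"
  using assms(2) by (cases rule: position_cases) (use assms(1) in \<open>auto simp: pperm_simps simp del: One_nat_def\<close>)

lemma pperm_permutes:
  assumes v: "v \<le> r - 2"
  shows "pperm r v permutes {1..2 * r - 2}"
proof (rule bij_imp_permutes)
  let ?N = "{1..2 * r - 2}"
  have "inj_on (pperm r v) ?N"
  proof (rule inj_onI)
    fix i j assume ij: "i \<in> ?N" "j \<in> ?N" "pperm r v i = pperm r v j"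
    from ij(3) have "pcol v i < pcol v j \<or> (pcol v i = pcol v j \<and> i div 2 \<le> j div 2)"
      unfolding pperm_le_iff[OF v ij(1,2)] by simp
    moreover from ij(3) have "pcol v j < pcol v i \<or> (pcol v j = pcol v i \<and> j div 2 \<le> i div 2)"
      unfolding pperm_le_iff[OF v ij(2,1)] by simp
    ultimately have "pcol v i = pcol v j \<and> i div 2 = j div 2"
      by (elim disjE conjE) simp_all
    then have "pnode v i = pnode v j" by (simp add: pnode_def)
    then show "i = j" using pnode_inj[of v] by (simp only: inj_eq)
  qed
  moreover have "pperm r v ` ?N \<subseteq> ?N" using pperm_range[OF v] by blast
  ultimately show "bij_betw (pperm r v) ?N ?N"
    by (simp add: bij_betw_def endo_inj_surj)
qed (auto simp: pperm_def)

lemma mem_pnode_image: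
  assumes r: "3 \<le> r"
  shows "(a, c) \<in> pnode v ` {1..2 * r - 2} \<longleftrightarrow>
    (2 \<le> a \<and> a \<le> r \<and> c = pcol v (2 * (a - 1))) \<or> (1 \<le> a \<and> a \<le> r - 1 \<and> c = pcol v (2 * (a - 1) + 1))"
    (is "?L \<longleftrightarrow> ?R")
proof
  assume ?L
  then obtain i where i: "i \<in> {1..2 * r - 2}" "(a, c) = pnode v i" by blast
  from i(1) show ?R
    by (cases rule: position_cases) (use i(2) in \<open>auto simp: pnode_def\<close>)
next
  assume ?R
  then show ?L
  proof
    assume h: "2 \<le> a \<and> a \<le> r \<and> c = pcol v (2 * (a - 1))"
    then have "2 * (a - 1) \<in> {1..2 * r - 2}" "pnode v (2 * (a - 1)) = (a, c)" by (auto simp: pnode_def)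
    then show ?L by (metis image_eqI)
  next
    assume h: "1 \<le> a \<and> a \<le> r - 1 \<and> c = pcol v (2 * (a - 1) + 1)"
    then have "2 * (a - 1) + 1 \<in> {1..2 * r - 2}" "pnode v (2 * (a - 1) + 1) = (a, c)"
      using r by (auto simp: pnode_def)
    then show ?L by (metis image_eqI)
  qed
qed

lemma P_diag_eq:
  assumes r: "3 \<le> r" and v: "v \<le> r - 2"
  shows "P_diag r v = pnode v ` {1..2 * r - 2}"
proof -
  have "(a, c) \<in> P_diag r v \<longleftrightarrow> (a, c) \<in> pnode v ` {1..2 * r - 2}" for a c
    unfolding mem_pnode_image[OF r] pcol_simps P_diag_def using r v
    by (cases "v = 0"; cases "v = r - 2") auto
  then show ?thesis by auto
qed

text \<open>The number of columns of the \<open>v\<close>-th diagram.\<close>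

definition ncols :: "nat \<Rightarrow> nat \<Rightarrow> nat" where
  "ncols r v = (if v = 0 then 1 else 2) + (if v < r - 2 then 1 else 0)"

lemma pcol_image:
  assumes r: "3 \<le> r" and v: "v \<le> r - 2"
  shows "pcol v ` {1..2 * r - 2} = {1..ncols r v}"
proof (intro equalityI subsetI)
  fix c assume "c \<in> pcol v ` {1..2 * r - 2}"
  then obtain i where i: "i \<in> {1..2 * r - 2}" "c = pcol v i" by blast
  from i(1) show "c \<in> {1..ncols r v}"
    by (cases rule: position_cases) (use i(2) r v in \<open>auto simp: pcol_simps ncols_def simp del: One_nat_def\<close>)
next
  fix c assume c: "c \<in> {1..ncols r v}"
  have 1: "pcol v 1 = (if v = 0 then 1 else 2)" using pcol_simps(2)[of v 0] by simp
  have 2: "v \<noteq> 0 \<Longrightarrow> pcol v (2 * 1) = 1" unfolding pcol_simps by simp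
  have 3: "v < r - 2 \<Longrightarrow> pcol v (2 * (r - 2) + 1) = ncols r v"
    unfolding pcol_simps ncols_def by auto
  have "c = pcol v 1 \<or> (v \<noteq> 0 \<and> c = pcol v (2 * 1)) \<or> (v < r - 2 \<and> c = pcol v (2 * (r - 2) + 1))"
    unfolding 1 using c 2 3 by (auto simp: ncols_def split: if_splits)
  moreover have "1 \<in> {1..2 * r - 2}" "2 * 1 \<in> {1..2 * r - 2}" "2 * (r - 2) + 1 \<in> {1..2 * r - 2}"
    using r by auto
  ultimately show "c \<in> pcol v ` {1..2 * r - 2}" by blast
qed

lemma num_cols_P_diag:
  assumes "3 \<le> r" and "v \<le> r - 2"
  shows "num_cols (P_diag r v) = ncols r v"
proof -
  have "snd ` P_diag r v = {1..ncols r v}"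
    unfolding P_diag_eq[OF assms] pcol_image[OF assms, symmetric] by (auto simp: pnode_def image_image)
  then show ?thesis by (simp add: num_cols_def)
qed

lemma P_diag_in_diagrams_of:
  assumes r: "3 \<le> r" and v: "v \<le> r - 2"
  shows "P_diag r v \<in> diagrams_of (lam_of r)"
proof -
  let ?N = "{1..2 * r - 2}"
  have f: "fst ` P_diag r v = {1..r}"
  proof -
    have "fst ` P_diag r v = (\<lambda>i. i div 2 + 1) ` ?N"
      unfolding P_diag_eq[OF r v] by (auto simp: pnode_def image_image)
    also have "\<dots> = {1..r}"
    proof (intro equalityI subsetI)
      fix k assume k: "k \<in> {1..r}"
      show "k \<in> (\<lambda>i. i div 2 + 1) ` ?N"
      proof (cases "k = 1")
        case True
        then show ?thesis using r by (intro image_eqI[of _ _ 1]) auto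
      next
        case False
        then show ?thesis using k by (intro image_eqI[of _ _ "2 * (k - 1)"]) auto
      qed
    qed (use r in auto)
    finally show ?thesis .
  qed
  have s: "snd ` P_diag r v = {1..ncols r v}"
    unfolding P_diag_eq[OF r v] pcol_image[OF r v, symmetric] by (auto simp: pnode_def image_image)
  have "card {x \<in> P_diag r v. fst x = k} = lam_of r ! (k - 1)" if k: "k \<in> {1..r}" for k
  proof -
    have "{x \<in> P_diag r v. fst x = k} = pnode v ` {i \<in> ?N. i div 2 + 1 = k}"
      unfolding P_diag_eq[OF r v] by (auto simp: pnode_def)
    then have "card {x \<in> P_diag r v. fst x = k} = card {i \<in> ?N. i div 2 + 1 = k}"
      using card_image[OF inj_on_subset[OF pnode_inj subset_UNIV]] by simp
    also have "{i \<in> ?N. i div 2 + 1 = k} =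
        (if k = 1 then {1} else if k = r then {2 * r - 2} else {2 * k - 2, 2 * k - 1})"
      using k r by (auto; presburger)
    also have "card \<dots> = lam_of r ! (k - 1)"
      using k r nth_lam_of[OF r, of "k - 1"] by auto
    finally show ?thesis .
  qed
  moreover have "finite (P_diag r v)" "P_diag r v \<noteq> {}"
    unfolding P_diag_eq[OF r v] using r by auto
  ultimately show ?thesis
    unfolding diagrams_of_def diagram_def using f s length_lam_of[OF r] by auto
qed

lemma div_mod_2_le_iff:
  fixes i j :: nat
  shows "i div 2 < j div 2 \<or> (i div 2 = j div 2 \<and> i mod 2 \<le> j mod 2) \<longleftrightarrow> i \<le> j"
proof -
  have "a < b \<or> (a = b \<and> c \<le> d) \<longleftrightarrow> 2 * a + c \<le> 2 * b + d" if "c < 2" "d < 2" for a b c d :: nat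
    using that by auto
  from this[of "i mod 2" "j mod 2" "i div 2" "j div 2"] show ?thesis
    unfolding mult_div_mod_eq by simp
qed

lemma w_of_P_diag:
  assumes r: "3 \<le> r" and v: "v \<le> r - 2"
  shows "w_of (P_diag r v) = pperm r v"
proof (rule w_of_eqI)
  let ?N = "{1..2 * r - 2}"
  note D = P_diag_in_diagrams_of[OF r v]
  show "finite (P_diag r v)" by (rule diagram_finite[OF D])
  show "pperm r v permutes {1..card (P_diag r v)}"
    unfolding lam_of_rows(1)[OF r D] by (rule pperm_permutes[OF v])
  fix x assume "x \<in> P_diag r v"
  then obtain i where i: "i \<in> ?N" "x = pnode v i" unfolding P_diag_eq[OF r v] by blast
  have inj: "inj_on (pnode v) ?N" using pnode_inj by (rule inj_on_subset) simp
  have "bij_betw (\<lambda>i. i) ?N ?N" using bij_betw_id[of ?N] by (simp add: id_def)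
  moreover have "fst (pnode v i) < fst (pnode v j) \<or> (fst (pnode v i) = fst (pnode v j) \<and> snd (pnode v i) \<le> snd (pnode v j)) \<longleftrightarrow> i \<le> j"
    for i j
  proof -
    have "i div 2 < j div 2 \<or> (i div 2 = j div 2 \<and> i mod 2 \<le> j mod 2) \<longleftrightarrow> i \<le> j"
      by (rule div_mod_2_le_iff)
    then show ?thesis by (auto simp: pnode_def pcol_def)
  qed
  ultimately have "row_filling (P_diag r v) (pnode v i) = i"
    unfolding row_filling_def P_diag_eq[OF r v] using i(1)
    by (intro rank_eq[OF inj, where f = "\<lambda>i. i"]) blast+
  moreover have "col_filling (P_diag r v) (pnode v i) = pperm r v i"
    unfolding col_filling_def P_diag_eq[OF r v] using i(1) permutes_imp_bij[OF pperm_permutes[OF v]]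
      pperm_le_iff[OF v]
    by (intro rank_eq[OF inj]) (auto simp: pnode_def)
  ultimately show "pperm r v (row_filling (P_diag r v) x) = col_filling (P_diag r v) x"
    using i(2) by simp
qed

text \<open>A map that is strictly monotone along a level function needs at least as many values as
  there are levels, and equals the level function when it has no more.\<close>

lemma level_bounds:
  fixes p C :: "'a \<Rightarrow> nat"
  assumes p: "p ` I = {1..c0}" and C: "C ` I \<subseteq> {1..c}"
    and mono: "\<And>i j. i \<in> I \<Longrightarrow> j \<in> I \<Longrightarrow> p i < p j \<Longrightarrow> C i < C j"
    and i: "i \<in> I"
  shows "p i \<le> C i" and "c0 + C i \<le> c + p i"
proof -
  have C': "1 \<le> C j \<and> C j \<le> c" if "j \<in> I" for j using C that by force
  have p': "1 \<le> p j \<and> p j \<le> c0" if "j \<in> I" for j using p that by force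
  show "p i \<le> C i"
    using i
  proof (induction "p i" arbitrary: i)
    case (Suc q)
    show ?case
    proof (cases "q = 0")
      case True
      then show ?thesis using Suc C'[of i] by simp
    next
      case False
      then have "q \<in> p ` I" using p'[OF Suc.prems] Suc.hyps(2) unfolding p by auto
      then obtain j where j: "j \<in> I" "q = p j" by blast
      then have "C j < C i" using mono[of j i] Suc by simp
      then show ?thesis using Suc.hyps(1)[of j] j Suc.hyps(2) by simp
    qed
  qed simp
  show "c0 + C i \<le> c + p i"
    using i
  proof (induction "c0 - p i" arbitrary: i)
    case 0
    then show ?case using C'[of i] p'[of i] by simp
  next
    case (Suc q)
    then have "Suc (p i) \<in> p ` I" using p'[OF Suc.prems] unfolding p by auto
    then obtain j where j: "j \<in> I" "p j = Suc (p i)" by force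
    then have "C i < C j" using mono[of i j] Suc by simp
    moreover have "c0 + C j \<le> c + p j" using Suc.hyps(1)[of j] j Suc.hyps(2) by linarith
    ultimately show ?case using j(2) by simp
  qed
qed

text \<open>In the filling by columns a descent of the row index forces a new column. The permutation
  of the \<open>v\<close>-th diagram visits the rows in the order
  \<open>2, \<dots>, v + 1 | 1, \<dots>, r | v + 2, \<dots>, r - 1\<close>, and a diagram with no columns beyond the ones
  forced at the bars has its column breaks exactly there.\<close>

lemma minimal_diagram:
  assumes r: "3 \<le> r" and v: "v \<le> r - 2" and E: "E \<in> diagrams_of (lam_of r)" and w: "w_of E = pperm r v"
  shows "ncols r v \<le> num_cols E" and "num_cols E \<le> ncols r v \<Longrightarrow> E = P_diag r v"
proof -
  let ?N = "{1..2 * r - 2}"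
  note fin = diagram_finite[OF E]
  have R: "bij_betw (row_filling E) E ?N"
    using row_filling_bij[OF fin] unfolding lam_of_rows(1)[OF r E] .
  define e where "e = inv_into E (row_filling E)"
  have eE: "e i \<in> E" and re: "row_filling E (e i) = i" if "i \<in> ?N" for i
    using that R by (auto simp: e_def bij_betw_def inv_into_into f_inv_into_f)
  define C where "C i = snd (e i)" for i
  have e: "e i = (i div 2 + 1, C i)" if "i \<in> ?N" for i
    using lam_of_rows(2)[OF r E eE[OF that]] re[OF that] by (simp add: C_def prod_eq_iff)
  have Ee: "E = e ` ?N"
    using bij_betw_inv_into[OF R] by (simp add: bij_betw_def e_def)
  have ce: "col_filling E (e i) = pperm r v i" if "i \<in> ?N" for i
    using w_of_spec[OF fin eE[OF that]] re[OF that] w by simp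
  have less: "C i < C j \<or> (C i = C j \<and> i div 2 < j div 2)"
    if "i \<in> ?N" "j \<in> ?N" "pperm r v i < pperm r v j" for i j
  proof (rule ccontr)
    assume "\<not> ?thesis"
    then have le: "C j < C i \<or> (C j = C i \<and> j div 2 \<le> i div 2)" by auto
    have "col_filling E (e j) \<le> col_filling E (e i)"
      unfolding col_filling_def
      by (rule card_mono) (use fin le in \<open>auto simp: e[OF that(1)] e[OF that(2)]\<close>)
    then show False using that ce by simp
  qed
  have le: "C i \<le> C j" if "i \<in> ?N" "j \<in> ?N" "pperm r v i \<le> pperm r v j" for i j
  proof (cases "pperm r v i = pperm r v j")
    case True
    then have "i = j" using permutes_inj[OF pperm_permutes[OF v]] by (simp add: inj_eq)
    then show ?thesis by simp
  qed (use less[of i j] that in auto)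
  \<comment> \<open>The nodes on the two sides of each column break, in positions \<open>2v\<close> and \<open>1\<close>, and
    \<open>2(r - 1)\<close> and \<open>2(v + 1) + 1\<close>.\<close>
  have p1: "pperm r v 1 = v + 1" "1 \<in> ?N" using r v by (auto simp: pperm_def)
  have p2: "pperm r v (2 * v) = v" "2 * v \<in> ?N" if "v \<noteq> 0"
    using r v that by (auto simp: pperm_def)
  have p3: "pperm r v (2 * (r - 1)) = v + r" "2 * (r - 1) \<in> ?N" if "v < r - 2"
    using r v that by (auto simp: pperm_def)
  have p4: "pperm r v (2 * (v + 1) + 1) = v + r + 1" "2 * (v + 1) + 1 \<in> ?N" if "v < r - 2"
    using r v that by (auto simp: pperm_def)
  have one: "C (2 * v) < C j" if "v \<noteq> 0" "j \<in> ?N" "v < pperm r v j" for j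
    using less[OF p2(2) p1(2)] le[OF p1(2) that(2)] p2[OF that(1)] p1 that by simp
  have two: "C i < C (2 * (v + 1) + 1)" if "v < r - 2" "i \<in> ?N" "pperm r v i \<le> v + r" for i
  proof -
    have "C (2 * (r - 1)) < C (2 * (v + 1) + 1)"
      using less[OF p3(2) p4(2)] p3(1) p4(1) that by simp linarith
    moreover have "C i \<le> C (2 * (r - 1))" using le[OF that(2) p3(2)] p3(1) that by simp
    ultimately show ?thesis by simp
  qed
  have mono: "C i < C j" if i: "i \<in> ?N" and j: "j \<in> ?N" and p: "pcol v i < pcol v j" for i j
  proof -
    have "(v \<noteq> 0 \<and> pperm r v i \<le> v \<and> v < pperm r v j) \<or>
        (v < r - 2 \<and> pperm r v i \<le> v + r \<and> v + r < pperm r v j)"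
      using i
    proof (cases rule: position_cases)
      case i': (1 k)
      from j show ?thesis
        by (cases rule: position_cases) (use i' v p in \<open>auto simp: pcol_simps pperm_simps simp del: One_nat_def split: if_splits\<close>)
    next
      case i': (2 k)
      from j show ?thesis
        by (cases rule: position_cases) (use i' v p in \<open>auto simp: pcol_simps pperm_simps simp del: One_nat_def split: if_splits\<close>)
    qed
    then show ?thesis
    proof (elim disjE conjE)
      assume h: "v \<noteq> 0" "pperm r v i \<le> v" "v < pperm r v j"
      have "C i \<le> C (2 * v)" using le[OF i p2(2)] p2(1) h by simp
      then show ?thesis using one[OF h(1) j h(3)] by simp
    next
      assume h: "v < r - 2" "pperm r v i \<le> v + r" "v + r < pperm r v j"
      have "C (2 * (v + 1) + 1) \<le> C j"
        using le[OF p4(2) j] p4(1) h by simp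
      then show ?thesis using two[OF h(1) i h(2)] by simp
    qed
  qed
  obtain c where c: "snd ` E = {1..c}" using E by (auto simp: diagrams_of_def diagram_def)
  have nc: "num_cols E = c" using c by (simp add: num_cols_def)
  have "C ` ?N \<subseteq> {1..c}" unfolding c[symmetric] using eE by (auto simp: C_def)
  note b = level_bounds[OF pcol_image[OF r v] this mono]
  have 1: "1 \<in> ?N" using r by auto
  show "ncols r v \<le> num_cols E" unfolding nc using b[OF _ _ _ 1] by fastforce
  assume "num_cols E \<le> ncols r v"
  then have "C i = pcol v i" if "i \<in> ?N" for i
    using b[OF _ _ _ that] unfolding nc by fastforce
  then have "e i = pnode v i" if "i \<in> ?N" for i
    using e[OF that] that by (simp add: pnode_def)
  then show "E = P_diag r v" unfolding Ee P_diag_eq[OF r v] by (rule image_cong[OF refl])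
qed

lemma D_of_pperm:
  assumes r: "3 \<le> r" and v: "v \<le> r - 2"
  shows "D_of (pperm r v) (lam_of r) = P_diag r v"
  unfolding D_of_def
proof (rule the_equality)
  show "P_diag r v \<in> diagrams_of (lam_of r) \<and> w_of (P_diag r v) = pperm r v \<and>
      (\<forall>E\<in>diagrams_of (lam_of r). w_of E = pperm r v \<longrightarrow> num_cols (P_diag r v) \<le> num_cols E)"
    using P_diag_in_diagrams_of[OF r v] w_of_P_diag[OF r v] num_cols_P_diag[OF r v] minimal_diagram(1)[OF r v]
    by simp
  fix E assume "E \<in> diagrams_of (lam_of r) \<and> w_of E = pperm r v \<and>
      (\<forall>E'\<in>diagrams_of (lam_of r). w_of E' = pperm r v \<longrightarrow> num_cols E \<le> num_cols E')"
  then show "E = P_diag r v"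
    using P_diag_in_diagrams_of[OF r v] w_of_P_diag[OF r v] num_cols_P_diag[OF r v] minimal_diagram(2)[OF r v]
    by metis
qed

text \<open>The columns of a Young diagram, as sets of rows, form a chain under inclusion, and this
  is invariant under permuting rows and columns.\<close>

lemma special_nested:
  assumes "special D" and "(a, b) \<in> D" and "(c, d) \<in> D"
  shows "(a, d) \<in> D \<or> (c, b) \<in> D"
proof -
  obtain mu \<sigma> \<tau> where D: "D = (\<lambda>(a, b). (\<sigma> a, \<tau> b)) ` young_diagram mu"
    using assms(1) by (auto simp: special_def)
  obtain a' b' where 1: "(a', b') \<in> young_diagram mu" "a = \<sigma> a'" "b = \<tau> b'" using assms(2) D by auto
  obtain c' d' where 2: "(c', d') \<in> young_diagram mu" "c = \<sigma> c'" "d = \<tau> d'" using assms(3) D by auto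
  have "(a', d') \<in> young_diagram mu \<or> (c', b') \<in> young_diagram mu"
    using 1(1) 2(1) by (auto simp: young_diagram_def)
  then show ?thesis unfolding D using 1 2 by force
qed

lemma special_ends:
  assumes r: "3 \<le> r" and v: "v = 0 \<or> v = r - 2"
  shows "special (P_diag r v)"
proof -
  \<comment> \<open>The rows \<open>1, \<dots>, r - 2\<close> of length 2 have to become the rows \<open>2, \<dots>, r - 1\<close>; interchanging
    1 and \<open>r - 1\<close> does this. For \<open>v = r - 2\<close> the two columns are interchanged as well.\<close>
  define mu :: "nat list" where "mu = replicate (r - 2) 2 @ [1, 1]"
  define t :: nat where "t = (if v = 0 then 1 else 2)"
  have mem: "(a, b) \<in> young_diagram mu \<longleftrightarrow> 1 \<le> a \<and> a \<le> r \<and> 1 \<le> b \<and> b \<le> (if a \<le> r - 2 then 2 else 1)" for a b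
  proof -
    have "mu ! (a - 1) = (if a \<le> r - 2 then 2 else 1)" if "1 \<le> a" "a \<le> r"
    proof -
      have "a - 1 < r - 2 \<or> a - 1 = r - 2 \<or> a - 1 = Suc (r - 2)" using that r by auto
      then show ?thesis using that r by (auto simp: mu_def nth_append)
    qed
    moreover have "length mu = r" using r by (simp add: mu_def)
    ultimately show ?thesis by (auto simp: young_diagram_def)
  qed
  have "sorted_wrt (\<ge>) (replicate k (2::nat))" for k
    by (induction k) auto
  then have "is_partition mu" by (auto simp: is_partition_def mu_def sorted_wrt_append)
  moreover have "transpose 1 (r - 1) permutes fst ` young_diagram mu"
  proof (rule permutes_swap_id)
    have "(1, 1) \<in> young_diagram mu" "(r - 1, 1) \<in> young_diagram mu" using r by (auto simp: mem)
    then show "1 \<in> fst ` young_diagram mu" "r - 1 \<in> fst ` young_diagram mu" by force+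
  qed
  moreover have "transpose 1 t permutes snd ` young_diagram mu"
  proof (rule permutes_swap_id)
    have "(1, 1) \<in> young_diagram mu" "(1, t) \<in> young_diagram mu" using r by (auto simp: mem t_def)
    then show "1 \<in> snd ` young_diagram mu" "t \<in> snd ` young_diagram mu" by force+
  qed
  moreover have "P_diag r v = (\<lambda>(a, b). (transpose 1 (r - 1) a, transpose 1 t b)) ` young_diagram mu"
  proof -
    have im: "(a, b) \<in> (\<lambda>(a, b). (transpose 1 (r - 1) a, transpose 1 t b)) ` young_diagram mu \<longleftrightarrow>
        (transpose 1 (r - 1) a, transpose 1 t b) \<in> young_diagram mu" for a b
      by (force intro: image_eqI[of _ _ "(transpose 1 (r - 1) a, transpose 1 t b)"])
    have "(a, b) \<in> P_diag r v \<longleftrightarrow> (transpose 1 (r - 1) a, transpose 1 t b) \<in> young_diagram mu" for a b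
      unfolding mem using v r by (auto simp: P_diag_def t_def transpose_def split: if_splits)
    then show ?thesis using im by auto
  qed
  ultimately show ?thesis unfolding special_def by blast
qed

text \<open>The first and the third column are disjoint.\<close>

lemma not_special_middle:
  assumes "3 \<le> r" and "0 < v" and "v < r - 2"
  shows "\<not> special (P_diag r v)"
proof
  assume "special (P_diag r v)"
  moreover have "(2, 1) \<in> P_diag r v" "(r - 1, 3) \<in> P_diag r v" using assms by (auto simp: P_diag_def)
  ultimately have "(2, 3) \<in> P_diag r v \<or> (r - 1, 1) \<in> P_diag r v" by (rule special_nested)
  then show False using assms by (auto simp: P_diag_def)
qed

section \<open>Maximal elements of the cell\<close>

lemma pperm_in_Z_of:
  assumes r: "3 \<le> r" and v: "v \<le> r - 2"
  shows "pperm r v \<in> Z_of (lam_of r)"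
proof -
  have a: "pperm r v (2 * k) = (if k \<le> v then k else v + k + 1)" if "1 \<le> k" "k \<le> r - 1" for k
    using pperm_simps(1) that .
  have b: "pperm r v (2 * k + 1) = (if k \<le> v then v + k + 1 else r + k)" if "k \<le> r - 2" for k
    using pperm_simps(2)[of k r v] that r by simp
  have a': "pperm r v (2 * k + 2) = (if k < v then k + 1 else v + k + 2)" if "k \<le> r - 2" for k
    using a[of "Suc k"] that r by auto
  have "chains (pperm r v) (r - 2)"
    unfolding chains_def strict_mono_on_def using v by (auto simp: a b[unfolded Suc_eq_plus1[symmetric]])
  moreover have "pperm r v (2 * (r - 2)) < pperm r v (2 * (r - 2) + 2)"
    using a[of "r - 2"] a'[of "r - 2"] r v by auto
  moreover have "first_gap (pperm r v) v (Suc (r - 2))"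
    unfolding first_gap_def using v by (auto simp: a'[simplified] b[unfolded Suc_eq_plus1[symmetric]])
  ultimately show ?thesis
    unfolding Z_of_lam_of[OF r] using pperm_permutes[OF v] v by blast
qed

text \<open>If \<open>b v < a (v + 1)\<close>, then every pair not inverted by \<open>pperm r v\<close> is joined by the chains
  of \<open>a\<close> and \<open>b\<close> entries, the relations \<open>a i < b i\<close> and this one relation, so \<open>e\<close> does not invert
  it either.\<close>

lemma Invs_pperm_maximal:
  assumes r: "3 \<le> r" and e: "e \<in> Z_of (lam_of r)"
  obtains v where "v \<le> r - 2" "Invs (2 * r - 2) e \<subseteq> Invs (2 * r - 2) (pperm r v)"
proof -
  let ?n = "2 * r - 2" and ?m = "r - 2"
  from e obtain v where p: "e permutes {1..?n}" and c: "chains e ?m"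
    and last: "e (2 * ?m) < e (2 * ?m + 2)" and v: "v \<le> ?m" and fg: "first_gap e v (Suc ?m)"
    unfolding Z_of_lam_of[OF r] by blast
  have r1: "r - 1 = Suc ?m" using r by simp
  have a: "e (2 * k) \<le> e (2 * l)" if "1 \<le> k" "k \<le> l" "l \<le> r - 1" for k l
  proof -
    have x: "e (2 * i) \<le> e (2 * j)" if "1 \<le> i" "i \<le> j" "j \<le> ?m" for i j
      using chainsD(2)[OF c, of i j] that by (cases "i = j") auto
    show ?thesis
    proof (cases "l = Suc ?m")
      case True
      show ?thesis
      proof (cases "k = l")
        case False
        then have "e (2 * k) \<le> e (2 * ?m)" using x that True by simp
        then show ?thesis using last True by simp
      qed simp
    next
      case False
      then show ?thesis using x that r1 by simp
    qed
  qed
  have b: "e (2 * k + 1) \<le> e (2 * l + 1)" if "k \<le> l" "l + 2 \<le> r" for k l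
  proof -
    have "l \<le> ?m" using that by simp
    then show ?thesis using chainsD(3)[OF c, of k l] that by (cases "k = l") auto
  qed
  have ab: "e (2 * k) \<le> e (2 * l + 1)" if "1 \<le> k" "k \<le> l" "l + 2 \<le> r" for k l
  proof -
    have "l \<le> ?m" "l \<le> r - 1" using that by simp_all
    then show ?thesis using a[of k l] chainsD(1)[OF c, of l] that by simp
  qed
  have gap: "e (2 * v + 1) < e (2 * Suc v)" using fg v by (auto simp: first_gap_def)
  have ba: "e (2 * k + 1) \<le> e (2 * l)" if "k \<le> v" "v < l" "l \<le> r - 1" for k l
  proof -
    have "v + 2 \<le> r" "1 \<le> Suc v" "Suc v \<le> l" using that v r by simp_all
    then show ?thesis using b[of k v] a[of "Suc v" l] gap that by linarith
  qed
  have noninv: "e i \<le> e j" if ij: "i \<in> {1..?n}" "j \<in> {1..?n}" "i < j" "\<not> pperm r v j < pperm r v i" for i j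
    using ij(1)
  proof (cases rule: position_cases)
    case i: (1 k)
    from ij(2) show ?thesis
    proof (cases rule: position_cases)
      case (1 l)
      then show ?thesis using a[of k l] i ij(3) by simp
    next
      case (2 l)
      then show ?thesis using ab[of k l] i ij(3) by simp
    qed
  next
    case i: (2 k)
    from ij(2) show ?thesis
    proof (cases rule: position_cases)
      case j: (1 l)
      have "k \<le> v \<and> v < l"
        using ij(3,4) i j v pperm_simps(1)[OF j(2,3), of v] pperm_simps(2)[OF i(2), of v]
        by (auto split: if_splits)
      then show ?thesis using ba[of k l] i j by simp
    next
      case (2 l)
      then show ?thesis using b[of k l] i ij(3) by simp
    qed
  qed
  have "Invs ?n e \<subseteq> Invs ?n (pperm r v)"
  proof
    fix q assume "q \<in> Invs ?n e"
    then obtain i j where q: "q = (i, j)" and ij: "i \<in> {1..?n}" "j \<in> {1..?n}" "i < j" "e j < e i"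
      by (auto simp: Invs_def)
    have "pperm r v j < pperm r v i"
      using noninv[OF ij(1-3)] ij(4) by linarith
    then show "q \<in> Invs ?n (pperm r v)" using q ij by (simp add: Invs_def)
  qed
  then show ?thesis using that v by blast
qed

text \<open>The pair of positions of \<open>b u\<close> and \<open>a (u + 1)\<close> is inverted by \<open>pperm r v\<close> for every
  \<open>v\<close> other than \<open>u\<close>.\<close>

lemma Invs_pperm_incomparable:
  assumes r: "3 \<le> r" and u: "u \<le> r - 2" and v: "v \<le> r - 2"
    and sub: "Invs (2 * r - 2) (pperm r v) \<subseteq> Invs (2 * r - 2) (pperm r u)"
  shows "u = v"
proof (rule ccontr)
  assume ne: "u \<noteq> v"
  have val: "pperm r w (2 * u + 1) = (if u \<le> w then w + u + 1 else r + u)"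
    "pperm r w (2 * u + 2) = (if u < w then u + 1 else w + u + 2)" for w
    using pperm_simps(2)[of u r w] pperm_simps(1)[of "Suc u" r w] u r by auto
  have "(2 * u + 1, 2 * u + 2) \<in> Invs (2 * r - 2) (pperm r v)"
    unfolding Invs_def using val[of v] ne u v r by auto
  moreover have "(2 * u + 1, 2 * u + 2) \<notin> Invs (2 * r - 2) (pperm r u)"
    unfolding Invs_def using val[of u] by auto
  ultimately show False using sub by blast
qed

lemma Y_of_lam_of:
  assumes r: "3 \<le> r"
  shows "Y_of (lam_of r) = pperm r ` {0..r - 2}"
proof -
  let ?n = "2 * r - 2" and ?Z = "Z_of (lam_of r)"
  have perm: "e permutes {1..?n}" if "e \<in> ?Z" for e using that unfolding Z_of_lam_of[OF r] by blast
  have pre: "cox_prefix ?n x y \<longleftrightarrow> Invs ?n x \<subseteq> Invs ?n y" if "x \<in> ?Z" "y \<in> ?Z" for x y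
    by (rule cox_prefix_iff[OF perm[OF that(1)] perm[OF that(2)]])
  have Y: "Y_of (lam_of r) = {x \<in> ?Z. \<forall>y\<in>?Z. Invs ?n x \<subseteq> Invs ?n y \<longrightarrow> y = x}"
    unfolding Y_of_def sum_list_lam_of[OF r] using pre by blast
  show ?thesis
    unfolding Y
  proof (intro equalityI subsetI)
    fix x assume x: "x \<in> {x \<in> ?Z. \<forall>y\<in>?Z. Invs ?n x \<subseteq> Invs ?n y \<longrightarrow> y = x}"
    then obtain v where "v \<le> r - 2" "Invs ?n x \<subseteq> Invs ?n (pperm r v)"
      using Invs_pperm_maximal[OF r] by blast
    then show "x \<in> pperm r ` {0..r - 2}" using x pperm_in_Z_of[OF r] by auto
  next
    fix x assume "x \<in> pperm r ` {0..r - 2}"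
    then obtain v where v: "v \<le> r - 2" and x: "x = pperm r v" by auto
    have "y = x" if y: "y \<in> ?Z" "Invs ?n x \<subseteq> Invs ?n y" for y
    proof -
      obtain u where u: "u \<le> r - 2" "Invs ?n y \<subseteq> Invs ?n (pperm r u)"
        using Invs_pperm_maximal[OF r y(1)] .
      then have "u = v" using Invs_pperm_incomparable[OF r u(1) v] y(2) x by blast
      then have "Invs ?n x = Invs ?n y" using u(2) y(2) x by blast
      then show ?thesis
        using Invs_inject[OF perm[OF y(1)]] pperm_permutes[OF v] x by metis
    qed
    then show "x \<in> {x \<in> ?Z. \<forall>y\<in>?Z. Invs ?n x \<subseteq> Invs ?n y \<longrightarrow> y = x}"
      using pperm_in_Z_of[OF r v] x by blast
  qed
qed

theorem theorem4p8:
  fixes r n :: nat and lam :: "nat list"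
  assumes "r \<ge> 3" and "n = 2 * r - 2" and "lam = lam_of r"
  shows "is_composition n lam
    \<and> E_of lam = {P_diag r v |v. 0 \<le> v \<and> v \<le> r - 2}
    \<and> Es_of lam = {P_diag r 0, P_diag r (r - 2)}
    \<and> card (Es_of lam) = 2
    \<and> card (E_of lam) = r - 1"
proof -
  note r = assms(1)
  have "E_of lam = (\<lambda>y. D_of y lam) ` Y_of lam" by (auto simp: E_of_def)
  also have "\<dots> = P_diag r ` {0..r - 2}"
    unfolding assms(3) Y_of_lam_of[OF r] image_image by (rule image_cong) (auto simp: D_of_pperm[OF r])
  finally have E: "E_of lam = P_diag r ` {0..r - 2}" .
  have inj: "inj_on (P_diag r) {0..r - 2}"
  proof (rule inj_onI)
    fix u v assume uv: "u \<in> {0..r - 2}" "v \<in> {0..r - 2}" "P_diag r u = P_diag r v"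
    then have "pperm r u 1 = pperm r v 1" using w_of_P_diag[OF r] by (metis atLeastAtMost_iff)
    then show "u = v" using r by (simp add: pperm_def)
  qed
  have "Es_of lam = {P_diag r 0, P_diag r (r - 2)}"
  proof -
    have "special (P_diag r v) \<longleftrightarrow> v = 0 \<or> v = r - 2" if "v \<le> r - 2" for v
      using special_ends[OF r] not_special_middle[OF r, of v] that
      by (metis bot_nat_0.not_eq_extremum le_neq_implies_less)
    then show ?thesis unfolding Es_of_def E by auto
  qed
  moreover have "P_diag r 0 \<noteq> P_diag r (r - 2)"
    using inj_onD[OF inj, of 0 "r - 2"] r by auto
  moreover have "card (E_of lam) = r - 1"
    unfolding E using card_image[OF inj] r by simp
  moreover have "E_of lam = {P_diag r v |v. 0 \<le> v \<and> v \<le> r - 2}" unfolding E by auto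
  ultimately show ?thesis using is_composition_lam_of[OF r] assms by simp
qed

end
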